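(* Let $V=\{z\in\mathbb{C}:0<|z|<1\}$, let $a\in V$, and let $T_V$ be the exit time from $V$ of a planar Brownian motion started at $a$. Then $B_{T_V}$ has density with respect to arclength on the unit circle given, for $\theta\in\mathbb{R}$, by $$\rho^a_{T_V}(e^{i\theta})=\sum_{k=-\infty}^{\infty}\frac{-\ln|a|}{\pi\big((\ln|a|)^2+(\arg(a)-(\theta+2\pi k))^2\big)}.$$
   Context: For a domain $U$, $T_U=\inf\{t\ge0:B_t\notin U\}$, and $\rho^a_{T_U}$ denotes the density of $B_{T_U}$ with respect to arclength on the boundary when $B_0=a$. $\arg(a)$ is any fixed value of the argument of $a$. *)

theory Defs
  imports "HOL-Probability.Probability" "HOL-Analysis.Complex_Transcendental"
begin

text \<open>All paths are required to be continuous, so that exit times from open sets are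
  measurable without completing \<open>M\<close>. Only times \<open>t \<ge> 0\<close> matter. Since
  \<open>B 0\<close> is almost surely constant, independence of \<open>B 0\<close> from the increments
  need not be demanded.\<close>

locale planar_brownian_motion = prob_space M
  for M :: "'w measure" and a :: complex and B :: "real \<Rightarrow> 'w \<Rightarrow> complex" +
  assumes random_variable: "0 \<le> t \<Longrightarrow> B t \<in> borel_measurable M"
    and start: "AE \<omega> in M. B 0 \<omega> = a"
    and continuous_paths: "\<omega> \<in> space M \<Longrightarrow> continuous_on {0..} (\<lambda>t. B t \<omega>)"
    and increment_Re: "\<lbrakk>0 \<le> s; s < t\<rbrakk> \<Longrightarrow>
      distributed M lborel (\<lambda>\<omega>. Re (B t \<omega> - B s \<omega>)) (normal_density 0 (sqrt (t - s)))"
    and increment_Im: "\<lbrakk>0 \<le> s; s < t\<rbrakk> \<Longrightarrow>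
      distributed M lborel (\<lambda>\<omega>. Im (B t \<omega> - B s \<omega>)) (normal_density 0 (sqrt (t - s)))"
    and increment_indep_Re_Im: "\<lbrakk>0 \<le> s; s < t\<rbrakk> \<Longrightarrow>
      indep_var borel (\<lambda>\<omega>. Re (B t \<omega> - B s \<omega>)) borel (\<lambda>\<omega>. Im (B t \<omega> - B s \<omega>))"
    and increments_indep: "\<lbrakk>0 \<le> \<tau> 0; \<And>i. i < n \<Longrightarrow> \<tau> i < \<tau> (Suc i)\<rbrakk> \<Longrightarrow>
      indep_vars (\<lambda>_. borel) (\<lambda>i \<omega>. B (\<tau> (Suc i)) \<omega> - B (\<tau> i) \<omega>) {..<n::nat}"

definition exit_time :: "(real \<Rightarrow> 'w \<Rightarrow> complex) \<Rightarrow> complex set \<Rightarrow> 'w \<Rightarrow> ereal" where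
  "exit_time B U \<omega> = (INF t\<in>{t. 0 \<le> t \<and> B t \<omega> \<notin> U}. ereal t)"

text \<open>On the event that the exit time is infinite, \<open>exit_point\<close> has the arbitrary
  value \<open>B 0 \<omega>\<close>.\<close>

definition exit_point :: "(real \<Rightarrow> 'w \<Rightarrow> complex) \<Rightarrow> complex set \<Rightarrow> 'w \<Rightarrow> complex" where
  "exit_point B U \<omega> = B (real_of_ereal (exit_time B U \<omega>)) \<omega>"

text \<open>Arclength on the unit circle, as a Borel measure on the plane: the image of Lebesgue
  measure under the unit-speed parametrisation \<open>cis\<close>.\<close>

definition circle_arclength :: "complex measure" where
  "circle_arclength = distr (restrict_space lborel {0..<2 * pi}) borel cis"

end

theory Submission
  imports Defs "HOL-Complex_Analysis.Complex_Analysis" "HOL-Real_Asymp.Real_Asymp"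
begin

text \<open>A planar Brownian path started at \<open>a \<noteq> 0\<close> never visits \<open>0\<close> (\<open>never_hits_zero\<close>) and leaves the
  unit disc (\<open>leaves_disc\<close>). So the exit from the punctured disc is almost surely the exit from the
  disc, and the exit point lies on the unit circle. The law of the exit point is the harmonic measure
  of the disc seen from \<open>a\<close>, which has the Poisson kernel as its density. The Poisson kernel is
  a wrapped Cauchy density, and this is the series in the theorem (\<open>wrapped_cauchy_eq_poisson_kernel\<close>):
  with \<open>exp (2 * pi * \<i> * w) = a / cis \<theta>\<close>, both sides are the real part of \<open>\<i> * cot (pi * w) / (2 * pi)\<close>,
  once as a function of \<open>a / cis \<theta>\<close> and once expanded into partial fractions.

  The harmonic measure is found without stochastic integration, from the functions
  \<open>exp (c * z)\<close> with \<open>c\<close> real. They reproduce themselves exactly under an isotropic Gaussian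
  step, because the factor \<open>exp (c\<^sup>2 * h / 2)\<close> from the real part cancels the factor
  \<open>exp (- (c\<^sup>2 * h / 2))\<close> from the imaginary part. Hence, if the path is sampled on a dyadic grid and
  frozen at the first grid time outside a given set, the expectation of \<open>exp (c * z)\<close> never changes
  (\<open>walk_exp\<close>). As the mesh tends to \<open>0\<close> and the sets exhaust the disc, the frozen values converge to
  the exit point, whose exponential moments are therefore \<open>exp (c * a)\<close> (\<open>exit_point_exp\<close>).
  Comparing Taylor coefficients in \<open>c\<close>, its power moments are \<open>a ^ n\<close>. The Poisson kernel has the same
  power moments by Cauchy's integral formula (\<open>poisson_kernel_moment\<close>), and a measure on the circle is
  determined by them, since trigonometric polynomials are dense (\<open>circle_measure_eqI\<close>).

  That \<open>0\<close> is avoided is seen with the same frozen walk and the \<open>1\<close>-resolvent kernel of Brownian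
  motion, a function with a logarithmic pole at \<open>0\<close> whose expectation grows at most by the
  factor \<open>exp h\<close> in a step of length \<open>h\<close> (\<open>walk_resolvent_kernel\<close>).\<close>

section \<open>The Poisson kernel as a wrapped Cauchy density\<close>

text \<open>The logarithmic derivative of the reflection formula for the Gamma function expresses the
  cotangent as a difference of two Digamma values, and each of these is a series of reciprocals.\<close>

lemma cot_partial_fractions:
  fixes w :: complex
  assumes w: "w \<notin> \<int>"
  shows "(\<lambda>n. inverse (w + of_nat n) + inverse (w - of_nat (Suc n))) sums (of_real pi * cot (of_real pi * w))"
proof -
  define u where "u = 1 - w"
  have u: "u \<notin> \<int>" using w unfolding u_def
    by (metis Ints_1 Ints_diff diff_diff_eq2 add_diff_cancel_left')
  have nw: "w \<notin> \<int>\<^sub>\<le>\<^sub>0" and nu: "u \<notin> \<int>\<^sub>\<le>\<^sub>0"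
    using w u nonpos_Ints_subset_Ints by auto
  have digamma: "(\<lambda>k. inverse (of_nat (Suc k)) - inverse (z + of_nat k)) sums (Digamma z + euler_mascheroni)" if "z \<notin> \<int>\<^sub>\<le>\<^sub>0" for z :: complex
  proof -
    have "z \<noteq> 0" using that by auto
    from summable_Digamma[OF this] show ?thesis
      by (simp add: Digamma_def summable_sums)
  qed
  have "(\<lambda>k. (inverse (of_nat (Suc k)) - inverse (u + of_nat k)) - (inverse (of_nat (Suc k)) - inverse (w + of_nat k)))
     sums ((Digamma u + euler_mascheroni) - (Digamma w + euler_mascheroni))"
    by (intro sums_diff digamma nu nw)
  moreover have "(inverse (of_nat (Suc k)) - inverse (u + of_nat k)) - (inverse (of_nat (Suc k)) - inverse (w + of_nat k))
     = inverse (w + of_nat k) + inverse (w - of_nat (Suc k))" for k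
  proof -
    have "u + of_nat k = - (w - of_nat (Suc k))" by (simp add: u_def)
    then show ?thesis by (simp only: inverse_minus_eq) simp
  qed
  ultimately have s: "(\<lambda>k. inverse (w + of_nat k) + inverse (w - of_nat (Suc k))) sums (Digamma u - Digamma w)"
    by (simp only: add_diff_cancel_right)
  have sinnz: "sin (of_real pi * w) \<noteq> 0"
  proof
    assume "sin (of_real pi * w) = 0"
    then obtain n :: int where "of_real pi * w = of_real n * of_real pi"
      by (auto simp: sin_eq_0)
    then have "w = of_int n" by simp
    with w show False by simp
  qed
  have refl: "rGamma z * rGamma (1 - z) = sin (of_real pi * z) / of_real pi" for z :: complex
    by (rule rGamma_reflection_complex)
  have d1: "((\<lambda>z. rGamma z * rGamma (1 - z)) has_field_derivative
      (- rGamma w * Digamma w) * rGamma (1 - w) + rGamma w * (rGamma u * Digamma u)) (at w)"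
    using nw nu by (auto intro!: derivative_eq_intros simp: u_def algebra_simps)
  have d2: "((\<lambda>z. sin (of_real pi * z) / of_real pi) has_field_derivative cos (of_real pi * w)) (at w)"
    by (auto intro!: derivative_eq_intros)
  have "(- rGamma w * Digamma w) * rGamma (1 - w) + rGamma w * (rGamma u * Digamma u) = cos (of_real pi * w)"
    using DERIV_unique[OF d1] d2 by (simp add: refl)
  then have "rGamma w * rGamma u * (Digamma u - Digamma w) = cos (of_real pi * w)"
    by (simp add: u_def algebra_simps)
  then have "sin (of_real pi * w) / of_real pi * (Digamma u - Digamma w) = cos (of_real pi * w)"
    using refl[of w] by (simp add: u_def)
  then have "Digamma u - Digamma w = of_real pi * cot (of_real pi * w)"
    using sinnz by (simp add: cot_def field_simps)
  with s show ?thesis by simp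
qed

lemma has_sum_int_of_sums:
  fixes f :: "int \<Rightarrow> real"
  assumes nn: "\<And>k. 0 \<le> f k" and s: "(\<lambda>n. f (- int n) + f (int (Suc n))) sums S"
  shows "(f has_sum S) UNIV"
proof -
  have s1: "summable (\<lambda>n. f (- int n))" and s2: "summable (\<lambda>n. f (int (Suc n)))"
    by (rule summable_comparison_test'[OF sums_summable[OF s], of 0], use nn in auto)+
  have "((\<lambda>n. f (- int n)) has_sum (\<Sum>n. f (- int n))) UNIV"
    by (rule sums_nonneg_imp_has_sum) (use nn s1 in \<open>auto simp: summable_sums\<close>)
  then have h1: "(f has_sum (\<Sum>n. f (- int n))) (range (\<lambda>n. - int n))"
    by (subst has_sum_reindex) (auto simp: inj_on_def o_def)
  have "((\<lambda>n. f (int (Suc n))) has_sum (\<Sum>n. f (int (Suc n)))) UNIV"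
    by (rule sums_nonneg_imp_has_sum) (use nn s2 in \<open>auto simp: summable_sums\<close>)
  then have h2: "(f has_sum (\<Sum>n. f (int (Suc n)))) (range (\<lambda>n. int (Suc n)))"
    by (subst has_sum_reindex) (auto simp: inj_on_def o_def)
  have "range (\<lambda>n. - int n) \<inter> range (\<lambda>n. int (Suc n)) = {}" by auto
  from has_sum_Un_disjoint[OF h1 h2 this]
  have "(f has_sum ((\<Sum>n. f (- int n)) + (\<Sum>n. f (int (Suc n))))) (range (\<lambda>n. - int n) \<union> range (\<lambda>n. int (Suc n)))" .
  moreover have "range (\<lambda>n. - int n) \<union> range (\<lambda>n. int (Suc n)) = UNIV"
  proof -
    have "k \<in> range (\<lambda>n. - int n) \<union> range (\<lambda>n. int (Suc n))" for k
    proof (cases "k \<le> 0")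
      case True
      then have "k = - int (nat (- k))" by simp
      then show ?thesis by blast
    next
      case False
      then have "k = int (Suc (nat (k - 1)))" by simp
      then show ?thesis by blast
    qed
    then show ?thesis by blast
  qed
  moreover have "(\<Sum>n. f (- int n)) + (\<Sum>n. f (int (Suc n))) = S"
    using suminf_add[OF s1 s2] s by (simp add: sums_iff)
  ultimately show ?thesis by simp
qed

text \<open>On the unit circle this is the usual \<open>(1 - \<bar>a\<bar>\<^sup>2) / (2 * pi * \<bar>z - a\<bar>\<^sup>2)\<close>. The form chosen here
  is the one in which the cotangent appears.\<close>

definition poisson_kernel :: "complex \<Rightarrow> complex \<Rightarrow> real" where
  "poisson_kernel a z = Re ((z + a) / (z - a)) / (2 * pi)"

lemma wrapped_cauchy_eq_poisson_kernel:
  fixes a :: complex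
  assumes a: "a \<noteq> 0" "cmod a < 1" and arg: "is_Arg a \<alpha>"
  shows "((\<lambda>k::int. - ln (cmod a) / (pi * ((ln (cmod a))\<^sup>2 + (\<alpha> - (\<theta> + 2 * pi * of_int k))\<^sup>2)))
            has_sum poisson_kernel a (cis \<theta>)) UNIV"
proof -
  define L where "L = - ln (cmod a)"
  have L: "L > 0" using a by (simp add: L_def)
  define u where "u = \<alpha> - \<theta>"
  \<comment> \<open>The point with \<open>exp (2 * pi * \<i> * w) = a / cis \<theta>\<close>: the summands are \<open>- Im (1 / (w - k)) / (2 * pi\<^sup>2)\<close>.\<close>
  define w where "w = Complex (u / (2 * pi)) (L / (2 * pi))"
  define f where "f k = L / (pi * (L\<^sup>2 + (u - 2 * pi * of_int k)\<^sup>2))" for k :: int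
  have Imw: "Im w > 0" using L by (simp add: w_def)
  have w: "w \<notin> \<int>"
    using Imw by (auto simp: complex_is_Int_iff)
  have Im_term: "Im (inverse (w - of_int k)) = - 2 * pi\<^sup>2 * f k" for k
  proof -
    have pos: "L\<^sup>2 + (u - 2 * pi * of_int k)\<^sup>2 > 0"
      using L by (intro add_pos_nonneg) auto
    have "(Re w - of_int k)\<^sup>2 + (Im w)\<^sup>2 = (L\<^sup>2 + (u - 2 * pi * of_int k)\<^sup>2) / (4 * pi\<^sup>2)"
      by (simp add: w_def power2_eq_square field_simps)
    then have "Im (inverse (w - of_int k)) = - (L / (2 * pi)) / ((L\<^sup>2 + (u - 2 * pi * of_int k)\<^sup>2) / (4 * pi\<^sup>2))"
      by (simp add: w_def)
    also have "\<dots> = - 2 * pi\<^sup>2 * f k"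
      using pos unfolding f_def by (simp add: power2_eq_square divide_simps)
    finally show ?thesis .
  qed
  have "(\<lambda>n. Im (inverse (w + of_nat n) + inverse (w - of_nat (Suc n)))) sums Im (of_real pi * cot (of_real pi * w))"
    by (rule sums_Im[OF cot_partial_fractions[OF w]])
  moreover have "Im (inverse (w + of_nat n) + inverse (w - of_nat (Suc n))) = (- 2 * pi\<^sup>2) * (f (- int n) + f (int (Suc n)))" for n
    using Im_term[of "- int n"] Im_term[of "int (Suc n)"] by (simp only: plus_complex.sel) (simp add: algebra_simps)
  ultimately have "(\<lambda>n. (- 2 * pi\<^sup>2) * (f (- int n) + f (int (Suc n)))) sums (pi * Im (cot (of_real pi * w)))"
    by simp
  from sums_mult[OF this, of "- 1 / (2 * pi\<^sup>2)"]
  have "(\<lambda>n. f (- int n) + f (int (Suc n))) sums (- Im (cot (of_real pi * w)) / (2 * pi))"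
    by (simp add: power2_eq_square add.commute)
  then have "(f has_sum (- Im (cot (of_real pi * w)) / (2 * pi))) UNIV"
    by (intro has_sum_int_of_sums) (use L in \<open>auto simp: f_def\<close>)
  moreover have "- Im (cot (of_real pi * w)) = Re ((cis \<theta> + a) / (cis \<theta> - a))"
  proof -
    \<comment> \<open>Both sides are a Moebius function of \<open>q\<^sup>2 = a / cis \<theta>\<close>.\<close>
    define q where "q = exp (\<i> * (of_real pi * w))"
    have q0: "q \<noteq> 0" by (simp add: q_def)
    have "sin (of_real pi * w) = (q - inverse q) / (2 * \<i>)" "cos (of_real pi * w) = (q + inverse q) / 2"
      by (simp_all add: sin_exp_eq cos_exp_eq q_def exp_minus)
    moreover have "(x / 2) / (y / (2 * \<i>)) = \<i> * x / y" for x y :: complex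
      by (cases "y = 0") (simp_all add: divide_simps)
    ultimately have c: "cot (of_real pi * w) = \<i> * (q + inverse q) / (q - inverse q)"
      by (simp only: cot_def)
    have q2: "q\<^sup>2 = a / cis \<theta>"
    proof -
      have "q\<^sup>2 = exp (2 * (\<i> * (of_real pi * w)))" by (simp add: q_def flip: exp_double)
      also have "2 * (\<i> * (of_real pi * w)) = of_real (- L) + \<i> * of_real u"
        by (simp add: w_def complex_eq_iff)
      also have "exp \<dots> = of_real (exp (- L)) * (exp (\<i> * \<alpha>) / exp (\<i> * \<theta>))"
        by (simp only: exp_add exp_of_real) (simp add: u_def right_diff_distrib exp_diff)
      also have "exp (- L) = cmod a" using a by (simp add: L_def)
      also have "of_real (cmod a) * (exp (\<i> * \<alpha>) / exp (\<i> * \<theta>)) = a / cis \<theta>"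
        using arg by (simp add: is_Arg_def cis_conv_exp)
      finally show ?thesis .
    qed
    have e1: "a = q\<^sup>2 * cis \<theta>" using q2 by (simp add: field_simps)
    have "q\<^sup>2 \<noteq> 1"
    proof
      assume "q\<^sup>2 = 1" then have "a = cis \<theta>" using e1 by simp
      then show False using a by simp
    qed
    then have "q * q \<noteq> 1" by (simp add: power2_eq_square)
    then have "\<i> * cot (of_real pi * w) = - (q\<^sup>2 + 1) / (q\<^sup>2 - 1)"
      using q0 unfolding c by (simp add: field_simps power2_eq_square)
    also have "\<dots> = (cis \<theta> + a) / (cis \<theta> - a)"
    proof -
      have "cis \<theta> + a = cis \<theta> * (1 + q\<^sup>2)" "cis \<theta> - a = cis \<theta> * (1 - q\<^sup>2)" using e1 by (simp_all add: algebra_simps)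
      then show ?thesis using \<open>q\<^sup>2 \<noteq> 1\<close> by (simp add: divide_simps) (simp add: algebra_simps)
    qed
    finally show ?thesis
      by (metis Re_i_times)
  qed
  moreover have "f = (\<lambda>k::int. - ln (cmod a) / (pi * ((ln (cmod a))\<^sup>2 + (\<alpha> - (\<theta> + 2 * pi * of_int k))\<^sup>2)))"
    by (simp add: f_def L_def u_def fun_eq_iff diff_diff_eq)
  ultimately show ?thesis
    by (simp add: poisson_kernel_def)
qed

section \<open>Moments of the Poisson kernel\<close>

lemma integral_circle_arclength:
  fixes f :: "complex \<Rightarrow> 'b :: {banach, second_countable_topology}"
  assumes [measurable]: "f \<in> borel_measurable borel"
  shows "(\<integral>z. f z \<partial>circle_arclength) = (LINT t:{0..2*pi}|lborel. f (cis t))"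
proof -
  have c: "cis \<in> borel_measurable borel"
    by (intro borel_measurable_continuous_onI continuous_intros)
  have [measurable]: "cis \<in> restrict_space lborel {0..<2 * pi} \<rightarrow>\<^sub>M borel"
    by (rule measurable_restrict_space1) (use c in simp)
  have "(\<integral>z. f z \<partial>circle_arclength) = (\<integral>t. f (cis t) \<partial>restrict_space lborel {0..<2 * pi})"
    unfolding circle_arclength_def by (subst integral_distr) auto
  also have "\<dots> = (LINT t:{0..<2*pi}|lborel. f (cis t))"
    by (subst integral_restrict_space) (auto simp: set_lebesgue_integral_def)
  also have "\<dots> = (LINT t:{0..2*pi}|lborel. f (cis t))"
    unfolding set_lebesgue_integral_def
  proof (rule integral_cong_AE)
    show "AE x in lborel. indicat_real {0..<2 * pi} x *\<^sub>R f (cis x) = indicat_real {0..2 * pi} x *\<^sub>R f (cis x)"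
      using AE_lborel_singleton[of "2 * pi"] by eventually_elim (auto simp: indicator_def)
  qed (use c in measurable)
  finally show ?thesis .
qed

lemma poisson_kernel_nonneg:
  assumes "cmod a \<le> 1" "cmod z = 1"
  shows "0 \<le> poisson_kernel a z"
proof -
  have "0 \<le> Re ((z + a) / (z - a))"
  proof -
    have "Re ((z + a) * cnj (z - a)) = (cmod z)\<^sup>2 - (cmod a)\<^sup>2"
      unfolding cmod_power2 by (simp add: algebra_simps power2_eq_square)
    also have "\<dots> \<ge> 0" using assms by (simp add: power_le_one)
    finally show ?thesis
      by (subst complex_div_cnj) (simp del: times_complex.sel add: Re_divide_of_real flip: of_real_power)
  qed
  then show ?thesis by (simp add: poisson_kernel_def)
qed

lemma poisson_kernel_measurable [measurable]: "poisson_kernel a \<in> borel_measurable borel"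
  unfolding poisson_kernel_def[abs_def] by measurable

lemma poisson_kernel_continuous:
  assumes "cmod a < 1"
  shows "continuous_on UNIV (\<lambda>t. poisson_kernel a (cis t))"
proof -
  have "cis t - a \<noteq> 0" for t using assms by (metis eq_iff_diff_eq_0 less_irrefl norm_cis)
  then show ?thesis unfolding poisson_kernel_def by (intro continuous_intros) auto
qed

text \<open>For \<open>z\<close> on the circle, \<open>2 * pi\<close> times the kernel equals \<open>z / (z - a) + cnj a * z / (1 - cnj a * z)\<close>,
  since \<open>cnj z = 1 / z\<close>. Against \<open>z ^ n dz / z\<close>, the first summand contributes the value \<open>a ^ n\<close> of
  Cauchy's formula, and the second one is holomorphic in the disc and contributes nothing.\<close>

lemma poisson_kernel_moment:
  assumes a: "cmod a < 1"
  shows "(\<integral>z. poisson_kernel a z *\<^sub>R z ^ n \<partial>circle_arclength) = a ^ n"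
proof -
  have ne: "cis t - a \<noteq> 0" for t using a by (metis eq_iff_diff_eq_0 less_irrefl norm_cis)
  define F where "F z = z ^ n / (z - a) + cnj a * z ^ n / (1 - cnj a * z)" for z :: complex
  have ne2: "1 - cnj a * z \<noteq> 0" if "cmod z \<le> 1" for z
  proof
    assume "1 - cnj a * z = 0"
    then have "cmod (cnj a * z) = 1" by simp
    then have "cmod a * cmod z = 1" by (simp add: norm_mult)
    moreover have "cmod a * cmod z \<le> cmod a * 1" by (intro mult_left_mono that) auto
    ultimately show False using a by simp
  qed
  have 1: "((\<lambda>z. z ^ n / (z - a)) has_contour_integral (2 * of_real pi * \<i> * a ^ n)) (circlepath 0 1)"
    by (rule Cauchy_integral_circlepath) (use a in \<open>auto intro!: continuous_intros holomorphic_intros\<close>)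
  have 2: "((\<lambda>z. cnj a * z ^ n / (1 - cnj a * z)) has_contour_integral 0) (circlepath 0 1)"
  proof -
    have "((\<lambda>z. (cnj a * z ^ n * z / (1 - cnj a * z)) / (z - 0)) has_contour_integral
       (2 * of_real pi * \<i> * (cnj a * 0 ^ n * 0 / (1 - cnj a * 0)))) (circlepath 0 1)"
      by (rule Cauchy_integral_circlepath) (use ne2 in \<open>auto intro!: continuous_intros holomorphic_intros\<close>)
    then have "((\<lambda>z. (cnj a * z ^ n * z / (1 - cnj a * z)) / (z - 0)) has_contour_integral 0) (circlepath 0 1)"
      by (simp only: mult_zero_right div_0)
    then show ?thesis
      by (rule has_contour_integral_eq) auto
  qed
  have "(F has_contour_integral (2 * of_real pi * \<i> * a ^ n)) (circlepath 0 1)"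
    using has_contour_integral_add[OF 1 2] unfolding F_def by simp
  then have "((\<lambda>t. F (cis t) * \<i> * cis t) has_integral (2 * of_real pi * \<i> * a ^ n)) {0..2*pi}"
    unfolding circlepath_def by (subst (asm) has_contour_integral_part_circlepath_iff) auto
  moreover have pk: "F (cis t) * \<i> * cis t = (2 * pi * \<i>) * (poisson_kernel a (cis t) *\<^sub>R cis t ^ n)" for t
  proof -
    define z where "z = cis t"
    have z: "z * cnj z = 1" "z - a \<noteq> 0" "z \<noteq> 0" using ne[of t] by (auto simp: z_def complex_mult_cnj)
    have nz: "1 - cnj a * z \<noteq> 0" using ne2[of z] by (simp add: z_def)
    have cz: "cnj z = 1 / z" using z by (simp add: field_simps)
    have "complex_of_real (2 * pi * poisson_kernel a z) = of_real (Re ((z + a) / (z - a)))"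
      by (simp add: poisson_kernel_def)
    also have "\<dots> = ((z + a) / (z - a) + cnj ((z + a) / (z - a))) / 2"
      by (subst complex_add_cnj) simp
    also have "cnj ((z + a) / (z - a)) = (1 + cnj a * z) / (1 - cnj a * z)"
    proof -
      have "cnj ((z + a) / (z - a)) = (1 / z + cnj a) / (1 / z - cnj a)" by (simp add: cz)
      also have "\<dots> = (1 + cnj a * z) / (1 - cnj a * z)" using z(3) nz by (simp add: divide_simps)
      finally show ?thesis .
    qed
    also have "((z + a) / (z - a) + (1 + cnj a * z) / (1 - cnj a * z)) / 2 = z / (z - a) + cnj a * z / (1 - cnj a * z)"
      using z(2) nz by (simp add: divide_simps) (simp add: algebra_simps)
    finally have p: "complex_of_real (2 * pi * poisson_kernel a z) = z / (z - a) + cnj a * z / (1 - cnj a * z)" .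
    have "F z * \<i> * z = \<i> * z ^ n * (z / (z - a) + cnj a * z / (1 - cnj a * z))"
      by (simp add: F_def algebra_simps)
    also have "\<dots> = (2 * pi * \<i>) * (poisson_kernel a z *\<^sub>R z ^ n)"
      unfolding p[symmetric] by (simp add: scaleR_conv_of_real)
    finally show ?thesis by (simp add: z_def)
  qed
  ultimately have "((\<lambda>t. (2 * pi * \<i>) * (poisson_kernel a (cis t) *\<^sub>R cis t ^ n)) has_integral (2 * of_real pi * \<i> * a ^ n)) {0..2*pi}"
    by simp
  from has_integral_mult_right[OF this, of "1 / (2 * pi * \<i>)"]
  have hi: "((\<lambda>t. poisson_kernel a (cis t) *\<^sub>R cis t ^ n) has_integral a ^ n) {0..2*pi}"
    by (simp add: field_simps)
  have cont: "continuous_on {0..2*pi} (\<lambda>t. poisson_kernel a (cis t) *\<^sub>R cis t ^ n)"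
    by (intro continuous_intros continuous_on_subset[OF poisson_kernel_continuous[OF a]]) auto
  have "set_integrable lborel {0..2*pi} (\<lambda>t. poisson_kernel a (cis t) *\<^sub>R cis t ^ n)"
    by (rule borel_integrable_atLeastAtMost') (rule cont)
  then have "(LINT t:{0..2*pi}|lborel. poisson_kernel a (cis t) *\<^sub>R cis t ^ n) = a ^ n"
    using set_borel_integral_eq_integral(2) hi integral_unique by metis
  then show ?thesis
    by (subst integral_circle_arclength) auto
qed

lemma AE_circle_arclength: "AE z in circle_arclength. cmod z = 1"
proof -
  have c: "cis \<in> borel_measurable borel"
    by (intro borel_measurable_continuous_onI continuous_intros)
  show ?thesis unfolding circle_arclength_def
    by (subst AE_distr_iff) (use c in \<open>auto intro!: measurable_restrict_space1\<close>)
qed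

section \<open>Measures on the circle are determined by their power moments\<close>

text \<open>Polynomials in \<open>z\<close> and \<open>cnj z\<close>. On the unit circle they are the trigonometric polynomials, and as
  functions of the plane they contain the real polynomials in the coordinates, for which the
  Weierstrass approximation theorem is available.\<close>

inductive conj_poly :: "(complex \<Rightarrow> complex) \<Rightarrow> bool" where
  monomial: "conj_poly (\<lambda>z. c * z ^ m * cnj z ^ n)"
| add: "conj_poly f \<Longrightarrow> conj_poly g \<Longrightarrow> conj_poly (\<lambda>z. f z + g z)"

lemma conj_poly_monomial_mult:
  assumes "conj_poly g" shows "conj_poly (\<lambda>z. (c * z ^ m * cnj z ^ n) * g z)"
  using assms
proof induction
  case (monomial d k l)
  have "(\<lambda>z. (c * z ^ m * cnj z ^ n) * (d * z ^ k * cnj z ^ l)) = (\<lambda>z. (c * d) * z ^ (m + k) * cnj z ^ (n + l))"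
    by (simp add: fun_eq_iff power_add)
  then show ?case using conj_poly.monomial by metis
next
  case (add f g)
  then show ?case by (simp add: distrib_left conj_poly.add)
qed

lemma conj_poly_mult:
  assumes "conj_poly f" "conj_poly g" shows "conj_poly (\<lambda>z. f z * g z)"
  using assms
proof induction
  case (monomial c m n)
  then show ?case by (rule conj_poly_monomial_mult)
next
  case (add f h)
  then show ?case by (simp add: distrib_right conj_poly.add)
qed

lemma conj_poly_real_polynomial:
  fixes p :: "complex \<Rightarrow> real"
  assumes "real_polynomial_function p"
  shows "conj_poly (\<lambda>z. of_real (p z))"
  using assms
proof induction
  case (linear f)
  then have l: "linear f" by (rule bounded_linear.linear)
  have "of_real (f z) = Complex (f 1 / 2) (- f \<i> / 2) * z ^ 1 * cnj z ^ 0
      + Complex (f 1 / 2) (f \<i> / 2) * z ^ 0 * cnj z ^ 1" for z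
  proof -
    have "f z = f (Re z *\<^sub>R 1 + Im z *\<^sub>R \<i>)" by (simp add: scaleR_conv_of_real mult.commute flip: complex_eq)
    also have "\<dots> = Re z * f 1 + Im z * f \<i>" by (simp add: linear_add[OF l] linear_scale[OF l])
    finally show ?thesis by (simp add: complex_eq_iff algebra_simps)
  qed
  then have "(\<lambda>z. complex_of_real (f z)) = (\<lambda>z. Complex (f 1 / 2) (- f \<i> / 2) * z ^ 1 * cnj z ^ 0
      + Complex (f 1 / 2) (f \<i> / 2) * z ^ 0 * cnj z ^ 1)"
    by (rule ext)
  then show ?case by (simp only: conj_poly.add conj_poly.monomial)
next
  case (const c)
  then show ?case using conj_poly.monomial[of "of_real c" 0 0] by simp
next
  case (add f g)
  then show ?case by (simp add: conj_poly.add)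
next
  case (mult f g)
  then show ?case by (simp add: conj_poly_mult)
qed

lemma conj_poly_continuous: "conj_poly f \<Longrightarrow> continuous_on S f"
  by (induction rule: conj_poly.induct) (auto intro!: continuous_intros)

lemma circle_integrable_of_continuous:
  fixes f :: "complex \<Rightarrow> 'b :: {banach, second_countable_topology}"
  assumes "finite_measure \<mu>" "sets \<mu> = sets borel" "AE z in \<mu>. cmod z = 1" "continuous_on UNIV f"
  shows "integrable \<mu> f"
proof -
  have "compact (f ` sphere 0 1)"
    by (intro compact_continuous_image continuous_on_subset[OF assms(4)]) auto
  then obtain K where "\<forall>z\<in>sphere 0 1. norm (f z) \<le> K"
    by (auto simp: bounded_iff dest!: compact_imp_bounded)
  then have K: "norm (f z) \<le> K" if "cmod z = 1" for z
    using that by auto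
  show ?thesis
  proof (rule finite_measure.integrable_const_bound[OF assms(1)])
    show "AE z in \<mu>. norm (f z) \<le> K"
      using assms(3) by (auto elim!: eventually_mono intro: K)
  qed (simp add: borel_measurable_continuous_onI assms measurable_cong_sets[OF assms(2) refl])
qed

text \<open>Since \<open>z * cnj z = 1\<close> on the circle, a mixed moment is a power moment or the conjugate of one.\<close>

lemma circle_measure_moment:
  assumes "finite_measure \<mu>" "sets \<mu> = sets borel" "AE z in \<mu>. cmod z = 1"
  shows "(\<integral>z. z ^ m * cnj z ^ n \<partial>\<mu>) =
    (if n \<le> m then \<integral>z. z ^ (m - n) \<partial>\<mu> else cnj (\<integral>z. z ^ (n - m) \<partial>\<mu>))"
proof -
  have m: "f \<in> borel_measurable borel \<Longrightarrow> f \<in> borel_measurable \<mu>" for f :: "complex \<Rightarrow> complex"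
    by (simp add: measurable_cong_sets[OF assms(2) refl])
  have c: "(\<lambda>z. z ^ k * cnj z ^ l) \<in> borel_measurable borel" for k l
    by (intro borel_measurable_continuous_onI continuous_intros)
  have zc: "z * cnj z = 1" if "cmod z = 1" for z
    using that by (metis complex_norm_square of_real_1 power_one)
  show ?thesis
  proof (cases "n \<le> m")
    case True
    have "(\<integral>z. z ^ m * cnj z ^ n \<partial>\<mu>) = (\<integral>z. z ^ (m - n) \<partial>\<mu>)"
    proof (intro integral_cong_AE)
      show "AE z in \<mu>. z ^ m * cnj z ^ n = z ^ (m - n)"
        using assms(3)
      proof eventually_elim
        case (elim z)
        have "z ^ m = z ^ (m - n) * z ^ n"
          using True by (simp flip: power_add)
        then have "z ^ m * cnj z ^ n = z ^ (m - n) * (z * cnj z) ^ n"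
          by (simp only: power_mult_distrib mult.assoc)
        then show ?case using zc[OF elim] by simp
      qed
    qed (use c[of m n] c[of "m - n" 0] in \<open>simp_all add: m\<close>)
    then show ?thesis using True by simp
  next
    case False
    have "(\<integral>z. z ^ m * cnj z ^ n \<partial>\<mu>) = (\<integral>z. cnj (z ^ (n - m)) \<partial>\<mu>)"
    proof (intro integral_cong_AE)
      show "AE z in \<mu>. z ^ m * cnj z ^ n = cnj (z ^ (n - m))"
        using assms(3)
      proof eventually_elim
        case (elim z)
        have "cnj z ^ n = cnj z ^ (n - m) * cnj z ^ m"
          using False by (simp flip: power_add)
        then have "z ^ m * cnj z ^ n = cnj z ^ (n - m) * (z * cnj z) ^ m"
          by (simp only: power_mult_distrib mult_ac)
        then show ?case using zc[OF elim] by simp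
      qed
    qed (use c[of m n] c[of 0 "n - m"] in \<open>simp_all add: m\<close>)
    then show ?thesis using False Bochner_Integration.integral_cnj[of \<mu> "\<lambda>z. z ^ (n - m)"] by simp
  qed
qed

text \<open>Equal power moments give equal integrals of all polynomials in \<open>z\<close> and \<open>cnj z\<close>, hence of all
  continuous functions by uniform approximation on the circle. Continuous functions decreasing to the
  indicator of a closed set then give equality on closed sets, which generate the Borel sets.\<close>

theorem circle_measure_eqI:
  fixes \<mu> \<nu> :: "complex measure"
  assumes \<mu>: "finite_measure \<mu>" "sets \<mu> = sets borel" "AE z in \<mu>. cmod z = 1"
    and \<nu>: "finite_measure \<nu>" "sets \<nu> = sets borel" "AE z in \<nu>. cmod z = 1"
    and mom: "\<And>n. (\<integral>z. z ^ n \<partial>\<mu>) = (\<integral>z. z ^ n \<partial>\<nu>)"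
  shows "\<mu> = \<nu>"
proof -
  interpret \<mu>: finite_measure \<mu> by fact
  interpret \<nu>: finite_measure \<nu> by fact
  note int\<mu> = circle_integrable_of_continuous[OF \<mu>] and int\<nu> = circle_integrable_of_continuous[OF \<nu>]
  have poly: "(\<integral>z. f z \<partial>\<mu>) = (\<integral>z. f z \<partial>\<nu>)" if "conj_poly f" for f
    using that
  proof induction
    case (monomial c m n)
    have "(\<integral>z. z ^ m * cnj z ^ n \<partial>\<mu>) = (\<integral>z. z ^ m * cnj z ^ n \<partial>\<nu>)"
      by (simp add: circle_measure_moment[OF \<mu>] circle_measure_moment[OF \<nu>] mom)
    then show ?case by (simp add: mult.assoc)
  next
    case (add f g)
    then show ?case using int\<mu> int\<nu> conj_poly_continuous by (subst (1 2) Bochner_Integration.integral_add) auto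
  qed
  have mass: "measure \<mu> UNIV = measure \<nu> UNIV"
    using mom[of 0] sets_eq_imp_space_eq[OF \<mu>(2)] sets_eq_imp_space_eq[OF \<nu>(2)] by simp
  have cont: "(\<integral>z. f z \<partial>\<mu>) = (\<integral>z. f z \<partial>\<nu>)" if f: "continuous_on UNIV f" for f :: "complex \<Rightarrow> real"
  proof (rule ccontr)
    assume ne: "(\<integral>z. f z \<partial>\<mu>) \<noteq> (\<integral>z. f z \<partial>\<nu>)"
    define d where "d = \<bar>(\<integral>z. f z \<partial>\<mu>) - (\<integral>z. f z \<partial>\<nu>)\<bar>"
    define e where "e = d / (4 * (measure \<mu> UNIV + 1))"
    have d: "d > 0" using ne by (simp add: d_def)
    have mp: "measure \<mu> UNIV + 1 > 0" by (intro add_nonneg_pos) auto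
    have e: "e > 0" using d mp by (simp add: e_def)
    have "compact (sphere (0::complex) 1)" "continuous_on (sphere 0 1) f"
      using f by (auto intro: continuous_on_subset)
    from Stone_Weierstrass_real_polynomial_function[OF this e]
    obtain p where p: "real_polynomial_function p" "\<And>z. z \<in> sphere 0 1 \<Longrightarrow> \<bar>f z - p z\<bar> < e" by metis
    have pc: "continuous_on UNIV p"
      using p(1) by (metis continuous_at_imp_continuous_on continuous_real_polymonial_function)
    have "complex_of_real (\<integral>z. p z \<partial>\<mu>) = complex_of_real (\<integral>z. p z \<partial>\<nu>)"
      using poly[OF conj_poly_real_polynomial[OF p(1)]] by simp
    then have pe: "(\<integral>z. p z \<partial>\<mu>) = (\<integral>z. p z \<partial>\<nu>)" by simp
    have bd: "\<bar>(\<integral>z. f z \<partial>\<kappa>) - (\<integral>z. p z \<partial>\<kappa>)\<bar> \<le> e * measure \<kappa> UNIV"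
      if "finite_measure \<kappa>" "sets \<kappa> = sets borel" "AE z in \<kappa>. cmod z = 1" for \<kappa>
    proof -
      interpret \<kappa>: finite_measure \<kappa> by fact
      note int\<kappa> = circle_integrable_of_continuous[OF that]
      have "\<bar>(\<integral>z. f z \<partial>\<kappa>) - (\<integral>z. p z \<partial>\<kappa>)\<bar> = \<bar>\<integral>z. f z - p z \<partial>\<kappa>\<bar>"
        using int\<kappa>[OF f] int\<kappa>[OF pc] by simp
      also have "\<dots> \<le> (\<integral>z. \<bar>f z - p z\<bar> \<partial>\<kappa>)" by (rule integral_abs_bound)
      also have "\<dots> \<le> (\<integral>z. e \<partial>\<kappa>)"
        using that(3) int\<kappa>[OF f] int\<kappa>[OF pc]
        by (intro integral_mono_AE) (auto elim!: eventually_mono intro!: less_imp_le[OF p(2)])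
      also have "\<dots> = e * measure \<kappa> UNIV" using sets_eq_imp_space_eq[OF that(2)] by simp
      finally show ?thesis .
    qed
    have "d \<le> 2 * (e * measure \<mu> UNIV)"
      using bd[OF \<mu>] bd[OF \<nu>] pe unfolding d_def mass by linarith
    also have "\<dots> \<le> 2 * (e * (measure \<mu> UNIV + 1))" using e by simp
    also have "\<dots> = d / 2" using mp by (simp add: e_def field_simps)
    finally show False using d by simp
  qed
  have closed: "measure \<mu> F = measure \<nu> F" if F: "closed F" "F \<noteq> {}" for F
  proof -
    \<comment> \<open>A Lipschitz function that is \<open>1\<close> on \<open>F\<close> and \<open>0\<close> at distance at least \<open>1 / n\<close> from \<open>F\<close>.\<close>
    define g :: "nat \<Rightarrow> complex \<Rightarrow> real" where "g n z = max 0 (1 - real n * infdist z F)" for n z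
    have gc: "continuous_on UNIV (g n)" for n unfolding g_def by (intro continuous_intros)
    have glim: "(\<lambda>n. g n z) \<longlonglongrightarrow> indicator F z" for z
    proof (cases "z \<in> F")
      case True then show ?thesis by (simp add: g_def)
    next
      case False
      then have "infdist z F > 0" using F by (metis in_closed_iff_infdist_zero infdist_nonneg less_eq_real_def)
      then obtain N where N: "1 < real N * infdist z F" using reals_Archimedean3 by blast
      have "\<forall>\<^sub>F n in sequentially. g n z = 0"
      proof (rule eventually_sequentiallyI[of N])
        fix n assume "N \<le> n"
        then have "real N * infdist z F \<le> real n * infdist z F" by (intro mult_right_mono) (auto simp: infdist_nonneg)
        then show "g n z = 0" using N by (simp add: g_def)
      qed
      then show ?thesis using False by (simp add: tendsto_eventually)
    qed
    have lim: "(\<lambda>n. \<integral>z. g n z \<partial>\<kappa>) \<longlonglongrightarrow> measure \<kappa> F"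
      if "finite_measure \<kappa>" "sets \<kappa> = sets borel" for \<kappa>
    proof -
      interpret \<kappa>: finite_measure \<kappa> by fact
      have Fs: "F \<in> sets \<kappa>" using F that by auto
      have m: "h \<in> borel_measurable borel \<Longrightarrow> h \<in> borel_measurable \<kappa>" for h :: "complex \<Rightarrow> real"
        by (simp add: measurable_cong_sets[OF that(2) refl])
      have "(\<lambda>n. \<integral>z. g n z \<partial>\<kappa>) \<longlonglongrightarrow> (\<integral>z. indicator F z \<partial>\<kappa>)"
      proof (rule integral_dominated_convergence[where w="\<lambda>_. 1"])
        show "g n \<in> borel_measurable \<kappa>" for n by (intro m borel_measurable_continuous_onI gc)
        show "AE z in \<kappa>. norm (g n z) \<le> 1" for n by (auto simp: g_def infdist_nonneg)
      qed (use glim Fs in auto)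
      then show ?thesis using Fs by (simp add: sets.sets_into_space Int_absorb2)
    qed
    have "(\<lambda>n. \<integral>z. g n z \<partial>\<mu>) \<longlonglongrightarrow> measure \<nu> F"
      using lim[OF \<nu>(1,2)] by (simp add: cont[OF gc])
    then show ?thesis using lim[OF \<mu>(1,2)] LIMSEQ_unique by blast
  qed
  show ?thesis
  proof (rule measure_eqI_generator_eq[where E="{F. closed F}" and \<Omega>=UNIV and A="\<lambda>_. UNIV"])
    show "emeasure \<mu> X = emeasure \<nu> X" if "X \<in> {F. closed F}" for X
      using that closed[of X] by (cases "X = {}") (auto simp: \<mu>.emeasure_eq_measure \<nu>.emeasure_eq_measure)
  qed (auto simp: Int_stable_def \<mu> \<nu> borel_eq_closed)
qed

section \<open>Gaussian integrals and the resolvent kernel of Brownian motion\<close>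

lemma (in prob_space) indep_var_nn_integral_iterated:
  assumes ind: "indep_var S X T Y" and F[measurable]: "F \<in> borel_measurable (S \<Otimes>\<^sub>M T)"
  shows "(\<integral>\<^sup>+\<omega>. F (X \<omega>, Y \<omega>) \<partial>M) = (\<integral>\<^sup>+\<omega>. (\<integral>\<^sup>+\<omega>'. F (X \<omega>, Y \<omega>') \<partial>M) \<partial>M)"
proof -
  have [measurable]: "X \<in> M \<rightarrow>\<^sub>M S" "Y \<in> M \<rightarrow>\<^sub>M T"
    and eq: "distr M S X \<Otimes>\<^sub>M distr M T Y = distr M (S \<Otimes>\<^sub>M T) (\<lambda>x. (X x, Y x))"
    using ind by (auto simp: indep_var_distribution_eq)
  interpret Y: prob_space "distr M T Y" by (rule prob_space_distr) simp
  have "(\<integral>\<^sup>+\<omega>. F (X \<omega>, Y \<omega>) \<partial>M) = (\<integral>\<^sup>+p. F p \<partial>(distr M S X \<Otimes>\<^sub>M distr M T Y))"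
    unfolding eq by (subst nn_integral_distr) auto
  also have "\<dots> = (\<integral>\<^sup>+x. (\<integral>\<^sup>+y. F (x, y) \<partial>distr M T Y) \<partial>distr M S X)"
    by (subst Y.nn_integral_fst) auto
  also have "\<dots> = (\<integral>\<^sup>+\<omega>. (\<integral>\<^sup>+y. F (X \<omega>, y) \<partial>distr M T Y) \<partial>M)"
    by (subst nn_integral_distr) auto
  also have "\<dots> = (\<integral>\<^sup>+\<omega>. (\<integral>\<^sup>+\<omega>'. F (X \<omega>, Y \<omega>') \<partial>M) \<partial>M)"
    by (intro nn_integral_cong nn_integral_distr) (auto intro: measurable_Pair_compose_split dest: measurable_space[OF \<open>X \<in> M \<rightarrow>\<^sub>M S\<close>])
  finally show ?thesis .
qed

lemma (in prob_space) normal_convolution: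
  assumes X: "distributed M lborel X (normal_density 0 \<tau>)" and pos: "0 < \<sigma>" "0 < \<tau>"
  shows "(\<integral>\<^sup>+\<omega>. ennreal (normal_density 0 \<sigma> (x + X \<omega>)) \<partial>M) = ennreal (normal_density 0 (sqrt (\<sigma>\<^sup>2 + \<tau>\<^sup>2)) x)"
proof -
  have "(\<integral>\<^sup>+\<omega>. ennreal (normal_density 0 \<sigma> (x + X \<omega>)) \<partial>M)
      = (\<integral>\<^sup>+y. ennreal (normal_density 0 \<tau> y) * ennreal (normal_density 0 \<sigma> (x + y)) \<partial>lborel)"
    by (rule distributed_nn_integral[OF X, symmetric]) simp
  also have "\<dots> = (\<integral>\<^sup>+y. ennreal (normal_density 0 \<tau> (- y)) * ennreal (normal_density 0 \<sigma> (x + - y)) \<partial>lborel)"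
    by (subst nn_integral_real_affine[where c="-1" and t=0]) auto
  also have "\<dots> = (\<integral>\<^sup>+y. ennreal (normal_density 0 \<sigma> (x - y) * normal_density 0 \<tau> y) \<partial>lborel)"
  proof (intro nn_integral_cong)
    fix y
    have "normal_density 0 \<tau> (- y) = normal_density 0 \<tau> y" by (simp add: normal_density_def)
    then show "ennreal (normal_density 0 \<tau> (- y)) * ennreal (normal_density 0 \<sigma> (x + - y))
      = ennreal (normal_density 0 \<sigma> (x - y) * normal_density 0 \<tau> y)"
      by (simp add: ennreal_mult'' mult.commute)
  qed
  also have "\<dots> = ennreal (normal_density 0 (sqrt (\<sigma>\<^sup>2 + \<tau>\<^sup>2)) x)"
    using conv_normal_density_zero_mean[OF pos] by (rule fun_cong)
  finally show ?thesis .
qed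

text \<open>Completing the square: the exponential tilts the normal density into a shifted normal density.\<close>

lemma (in prob_space) normal_exp_moment:
  assumes X: "distributed M lborel X (normal_density 0 \<sigma>)" and "0 < \<sigma>"
  shows "integrable M (\<lambda>\<omega>. exp (c * X \<omega>))" "expectation (\<lambda>\<omega>. exp (c * X \<omega>)) = exp (c\<^sup>2 * \<sigma>\<^sup>2 / 2)"
proof -
  have shift: "normal_density 0 \<sigma> x * exp (c * x) = exp (c\<^sup>2 * \<sigma>\<^sup>2 / 2) * normal_density (c * \<sigma>\<^sup>2) \<sigma> x" for x
  proof -
    have "- (x\<^sup>2) / (2 * \<sigma>\<^sup>2) + c * x = c\<^sup>2 * \<sigma>\<^sup>2 / 2 + - ((x - c * \<sigma>\<^sup>2)\<^sup>2) / (2 * \<sigma>\<^sup>2)"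
      using \<open>0 < \<sigma>\<close> by (simp add: field_simps power2_eq_square)
    then have "exp (- (x\<^sup>2) / (2 * \<sigma>\<^sup>2)) * exp (c * x) = exp (c\<^sup>2 * \<sigma>\<^sup>2 / 2) * exp (- ((x - c * \<sigma>\<^sup>2)\<^sup>2) / (2 * \<sigma>\<^sup>2))"
      by (simp only: exp_add[symmetric])
    then show ?thesis by (simp add: normal_density_def)
  qed
  have "integrable lborel (\<lambda>x. normal_density 0 \<sigma> x * exp (c * x))"
    unfolding shift using \<open>0 < \<sigma>\<close> by simp
  then show "integrable M (\<lambda>\<omega>. exp (c * X \<omega>))"
    by (subst (asm) distributed_integrable[OF X]) auto
  have "expectation (\<lambda>\<omega>. exp (c * X \<omega>)) = (\<integral>x. normal_density 0 \<sigma> x * exp (c * x) \<partial>lborel)"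
    by (rule distributed_integral[OF X, symmetric]) auto
  also have "\<dots> = exp (c\<^sup>2 * \<sigma>\<^sup>2 / 2)"
    unfolding shift using \<open>0 < \<sigma>\<close> by simp
  finally show "expectation (\<lambda>\<omega>. exp (c * X \<omega>)) = exp (c\<^sup>2 * \<sigma>\<^sup>2 / 2)" .
qed

lemma (in prob_space) normal_char:
  assumes X: "distributed M lborel X (normal_density 0 \<sigma>)" and "0 < \<sigma>"
  shows "expectation (\<lambda>\<omega>. exp (\<i> * complex_of_real (c * X \<omega>))) = exp (- (c\<^sup>2 * \<sigma>\<^sup>2 / 2))"
proof -
  have Y: "distributed M lborel (\<lambda>\<omega>. X \<omega> / \<sigma>) std_normal_density"
    using X normal_standard_normal_convert[OF \<open>0 < \<sigma>\<close>, of X 0] by simp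
  then have [measurable]: "(\<lambda>\<omega>. X \<omega> / \<sigma>) \<in> borel_measurable M"
    by (auto dest: distributed_measurable)
  have "char std_normal_distribution (c * \<sigma>) = (CLINT x|distr M lborel (\<lambda>\<omega>. X \<omega> / \<sigma>). iexp (c * \<sigma> * x))"
    unfolding char_def distributed_distr_eq_density[OF Y] ..
  also have "\<dots> = expectation (\<lambda>\<omega>. iexp (c * \<sigma> * (X \<omega> / \<sigma>)))"
    by (subst integral_distr) auto
  also have "(\<lambda>\<omega>. iexp (c * \<sigma> * (X \<omega> / \<sigma>))) = (\<lambda>\<omega>. exp (\<i> * complex_of_real (c * X \<omega>)))"
    using \<open>0 < \<sigma>\<close> by (simp add: fun_eq_iff)
  finally show ?thesis
    unfolding char_std_normal_distribution by (simp add: power_mult_distrib)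
qed

definition heat_kernel :: "real \<Rightarrow> complex \<Rightarrow> real" where
  "heat_kernel s z = exp (- (cmod z)\<^sup>2 / (2 * s)) / (2 * pi * s)"

lemma heat_kernel_eq_normal:
  assumes "0 < s"
  shows "heat_kernel s z = normal_density 0 (sqrt s) (Re z) * normal_density 0 (sqrt s) (Im z)"
proof -
  have "exp (- (cmod z)\<^sup>2 / (2 * s)) = exp (- (Re z)\<^sup>2 / (2 * s)) * exp (- (Im z)\<^sup>2 / (2 * s))"
    by (simp add: cmod_power2 add_divide_distrib diff_divide_distrib flip: exp_add)
  moreover have "sqrt (2 * pi * s) * sqrt (2 * pi * s) = 2 * pi * s" using assms by simp
  ultimately show ?thesis
    using assms by (simp add: heat_kernel_def normal_density_def)
qed

text \<open>The density at \<open>0\<close> of the expected occupation time of Brownian motion started at \<open>z\<close> and killed at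
  rate \<open>1\<close>. It is finite away from \<open>0\<close> and behaves like \<open>ln (1 / \<bar>z\<bar>)\<close> near \<open>0\<close>, and so it can
  detect visits to \<open>0\<close>. The killing only serves to make the integral converge at infinity.\<close>

definition resolvent_kernel :: "complex \<Rightarrow> ennreal" where
  "resolvent_kernel z = (\<integral>\<^sup>+s\<in>{0<..}. ennreal (exp (- s) * heat_kernel s z) \<partial>lborel)"

lemma resolvent_kernel_measurable [measurable]: "resolvent_kernel \<in> borel_measurable borel"
  unfolding resolvent_kernel_def[abs_def] heat_kernel_def by measurable

lemma resolvent_kernel_finite:
  assumes "z \<noteq> 0" shows "resolvent_kernel z < \<infinity>"
proof -
  define C where "C = 1 / (pi * (cmod z)\<^sup>2)"
  have C: "C \<ge> 0" by (simp add: C_def)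
  have K: "heat_kernel s z \<le> C" if "s > 0" for s
  proof -
    define t where "t = (cmod z)\<^sup>2 / (2 * s)"
    have "t * exp (- t) \<le> 1"
    proof -
      have "t \<le> exp t" using exp_ge_add_one_self[of t] by linarith
      then show ?thesis by (simp add: exp_minus field_simps)
    qed
    then have "t * exp (- t) * C \<le> 1 * C" using C by (rule mult_right_mono)
    moreover have "t * exp (- t) * C = heat_kernel s z"
      using assms that by (simp add: heat_kernel_def C_def t_def field_simps)
    ultimately show ?thesis by simp
  qed
  have "resolvent_kernel z \<le> (\<integral>\<^sup>+s. ennreal C * (ennreal (s ^ 0 * exp (- s)) * indicator {0..} s) \<partial>lborel)"
    unfolding resolvent_kernel_def
    by (intro nn_integral_mono) (auto simp: indicator_def ennreal_mult''[symmetric] C mult.commute intro!: ennreal_leI mult_left_mono K)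
  also have "\<dots> = ennreal C"
    by (subst nn_integral_cmult) (auto simp: nn_intergal_power_times_exp_Ici[of 0, simplified])
  finally show ?thesis by (simp add: le_less_trans)
qed

text \<open>Only the times \<open>s\<close> between \<open>\<epsilon>\<^sup>2\<close> and \<open>1\<close> are kept. For these both exponentials are bounded below,
  since \<open>\<bar>z\<bar>\<^sup>2 \<le> s\<close>, and the integral of \<open>1 / s\<close> produces the logarithm.\<close>

lemma resolvent_kernel_ge:
  assumes "cmod z \<le> \<epsilon>" "0 < \<epsilon>" "\<epsilon> \<le> 1"
  shows "ennreal (exp (- 3 / 2) / pi * ln (1 / \<epsilon>)) \<le> resolvent_kernel z"
proof -
  define c where "c = exp (- 3 / 2) / (2 * pi)"
  have e2: "0 < \<epsilon>\<^sup>2" "\<epsilon>\<^sup>2 \<le> 1" using assms by (auto simp: power_le_one)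
  have "(\<integral>\<^sup>+s. ennreal (c / s) * indicator {\<epsilon>\<^sup>2..1} s \<partial>lborel) = ennreal (c * ln 1 - c * ln (\<epsilon>\<^sup>2))"
  proof (rule nn_integral_FTC_Icc)
    fix s assume "s \<in> {\<epsilon>\<^sup>2..1}"
    then have s: "0 < s" using order.strict_trans2[OF e2(1)] by simp
    then show "((\<lambda>s. c * ln s) has_real_derivative c / s) (at s)"
      by (auto intro!: derivative_eq_intros)
    show "0 \<le> c / s" using s by (simp add: c_def)
  qed (use e2 in auto)
  also have "c * ln 1 - c * ln (\<epsilon>\<^sup>2) = exp (- 3 / 2) / pi * ln (1 / \<epsilon>)"
    using assms by (simp add: c_def ln_realpow ln_div)
  finally have "ennreal (exp (- 3 / 2) / pi * ln (1 / \<epsilon>)) = (\<integral>\<^sup>+s. ennreal (c / s) * indicator {\<epsilon>\<^sup>2..1} s \<partial>lborel)" ..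
  also have "\<dots> \<le> resolvent_kernel z"
    unfolding resolvent_kernel_def
  proof (intro nn_integral_mono)
    fix s :: real
    show "ennreal (c / s) * indicator {\<epsilon>\<^sup>2..1} s \<le> ennreal (exp (- s) * heat_kernel s z) * indicator {0<..} s"
    proof (cases "s \<in> {\<epsilon>\<^sup>2..1}")
      case True
      then have s: "0 < s" "s \<le> 1" using order.strict_trans2[OF e2(1)] by simp_all
      have "(cmod z)\<^sup>2 \<le> \<epsilon>\<^sup>2" using assms by (intro power_mono) auto
      also have "\<dots> \<le> s" using True by simp
      finally have "(cmod z)\<^sup>2 / (2 * s) \<le> 1 / 2" using s by (simp add: field_simps)
      then have "- 3 / 2 \<le> - s + - (cmod z)\<^sup>2 / (2 * s)"
        using s unfolding minus_divide_left[symmetric] by linarith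
      then have "exp (- 3 / 2) \<le> exp (- s) * exp (- (cmod z)\<^sup>2 / (2 * s))" by (simp flip: exp_add)
      then have "exp (- 3 / 2) / (2 * pi * s) \<le> exp (- s) * exp (- (cmod z)\<^sup>2 / (2 * s)) / (2 * pi * s)"
        using s by (intro divide_right_mono) auto
      then show ?thesis using True s by (auto simp: c_def heat_kernel_def intro!: ennreal_leI)
    qed auto
  qed
  finally show ?thesis .
qed

section \<open>The path on a grid, frozen outside a set\<close>

text \<open>The walk with steps \<open>d\<close>, frozen when it first leaves \<open>U\<close>. With a recursion in place of a
  stopping time, position \<open>k\<close> visibly depends on the steps before step \<open>k\<close> only, and is
  independent of step \<open>k\<close> when the steps are independent.\<close>

primrec stopped_walk :: "complex set \<Rightarrow> complex \<Rightarrow> (nat \<Rightarrow> complex) \<Rightarrow> nat \<Rightarrow> complex" where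
  "stopped_walk U a d 0 = a"
| "stopped_walk U a d (Suc k) =
    stopped_walk U a d k + (if stopped_walk U a d k \<in> U then d k else 0)"

lemma stopped_walk_cong: "(\<And>i. i < k \<Longrightarrow> d i = d' i) \<Longrightarrow> stopped_walk U a d k = stopped_walk U a d' k"
  by (induction k) auto

lemma stopped_walk_measurable:
  assumes [measurable]: "U \<in> sets borel"
  shows "k \<le> n \<Longrightarrow> (\<lambda>d. stopped_walk U a d k) \<in> borel_measurable (PiM {..<n} (\<lambda>_. borel))"
proof (induction k)
  case (Suc k)
  then have [measurable]: "(\<lambda>d. stopped_walk U a d k) \<in> borel_measurable (PiM {..<n} (\<lambda>_. borel))" by simp
  have [measurable]: "(\<lambda>d. d k) \<in> borel_measurable (PiM {..<n} (\<lambda>_. borel))"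
    using Suc.prems by (intro measurable_component_singleton) auto
  show ?case by simp
qed simp

lemma stopped_walk_partial_sum:
  assumes X: "X 0 = a" "\<And>i. X (Suc i) = X i + d i"
  shows "\<exists>k\<le>n. stopped_walk U a d n = X k \<and> (\<forall>i<k. X i \<in> U) \<and> (X k \<notin> U \<or> k = n)"
proof (induction n)
  case 0
  then show ?case using X by auto
next
  case (Suc n)
  then obtain k where k: "k \<le> n" "stopped_walk U a d n = X k" "\<forall>i<k. X i \<in> U" "X k \<notin> U \<or> k = n" by blast
  show ?case
  proof (cases "X k \<in> U")
    case True
    then have "k = n" using k by auto
    then show ?thesis using True k X(2) by (intro exI[of _ "Suc n"]) (auto simp: less_Suc_eq)
  next
    case False
    then show ?thesis using k by (intro exI[of _ k]) auto
  qed
qed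

context planar_brownian_motion
begin

definition increment :: "real \<Rightarrow> nat \<Rightarrow> 'w \<Rightarrow> complex" where
  "increment h k \<omega> = B (real (Suc k) * h) \<omega> - B (real k * h) \<omega>"

lemma increment_measurable: "0 < h \<Longrightarrow> increment h k \<in> borel_measurable M"
  unfolding increment_def[abs_def] by (intro borel_measurable_diff random_variable) auto

lemma increment_components:
  assumes h: "0 < h"
  shows "distributed M lborel (\<lambda>\<omega>. Re (increment h k \<omega>)) (normal_density 0 (sqrt h))"
    and "distributed M lborel (\<lambda>\<omega>. Im (increment h k \<omega>)) (normal_density 0 (sqrt h))"
    and "indep_var borel (\<lambda>\<omega>. Re (increment h k \<omega>)) borel (\<lambda>\<omega>. Im (increment h k \<omega>))"
proof -
  have t: "0 \<le> real k * h" "real k * h < real (Suc k) * h" "real (Suc k) * h - real k * h = h"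
    using h by (auto simp: algebra_simps)
  show "distributed M lborel (\<lambda>\<omega>. Re (increment h k \<omega>)) (normal_density 0 (sqrt h))"
    "distributed M lborel (\<lambda>\<omega>. Im (increment h k \<omega>)) (normal_density 0 (sqrt h))"
    "indep_var borel (\<lambda>\<omega>. Re (increment h k \<omega>)) borel (\<lambda>\<omega>. Im (increment h k \<omega>))"
    using increment_Re[OF t(1,2)] increment_Im[OF t(1,2)] increment_indep_Re_Im[OF t(1,2)]
    unfolding increment_def t(3) by auto
qed

text \<open>The planar Gaussian increment preserves \<open>exp (c * z)\<close> exactly: the exponential moment of the real
  part and the characteristic function of the imaginary part are reciprocal.\<close>

lemma increment_exp:
  fixes c :: real
  assumes h: "0 < h"
  shows "integrable M (\<lambda>\<omega>. exp (of_real c * increment h k \<omega>))"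
    and "expectation (\<lambda>\<omega>. exp (of_real c * increment h k \<omega>)) = 1"
proof -
  let ?X = "\<lambda>\<omega>. Re (increment h k \<omega>)" and ?Y = "\<lambda>\<omega>. Im (increment h k \<omega>)"
  have [measurable]: "increment h k \<in> borel_measurable M" by (rule increment_measurable[OF h])
  have s: "0 < sqrt h" using h by simp
  note X = normal_exp_moment[OF increment_components(1)[OF h, of k] s, of c]
  have eX: "integrable M (\<lambda>\<omega>. complex_of_real (exp (c * ?X \<omega>)))"
    using X(1) by (simp only: complex_of_real_integrable_eq)
  have eY: "integrable M (\<lambda>\<omega>. exp (\<i> * complex_of_real (c * ?Y \<omega>)))"
    by (rule integrable_const_bound[where B=1]) auto
  have ind: "indep_var borel (\<lambda>\<omega>. complex_of_real (exp (c * ?X \<omega>))) borel (\<lambda>\<omega>. exp (\<i> * complex_of_real (c * ?Y \<omega>)))"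
    using indep_var_compose[OF increment_components(3)[OF h, of k],
      of "\<lambda>x. complex_of_real (exp (c * x))" borel "\<lambda>y. exp (\<i> * complex_of_real (c * y))" borel]
    by (simp add: o_def)
  have split: "exp (of_real c * increment h k \<omega>)
      = complex_of_real (exp (c * ?X \<omega>)) * exp (\<i> * complex_of_real (c * ?Y \<omega>))" for \<omega>
  proof -
    have "of_real c * increment h k \<omega> = complex_of_real (c * ?X \<omega>) + \<i> * complex_of_real (c * ?Y \<omega>)"
      by (simp add: complex_eq_iff)
    then show ?thesis by (simp only: exp_add exp_of_real)
  qed
  show "integrable M (\<lambda>\<omega>. exp (of_real c * increment h k \<omega>))"
    unfolding split by (rule indep_var_integrable[OF ind eX eY])
  have "expectation (\<lambda>\<omega>. exp (of_real c * increment h k \<omega>))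
     = complex_of_real (exp (c\<^sup>2 * (sqrt h)\<^sup>2 / 2)) * complex_of_real (exp (- (c\<^sup>2 * (sqrt h)\<^sup>2 / 2)))"
    unfolding split indep_var_lebesgue_integral[OF ind eX eY]
      normal_char[OF increment_components(2)[OF h] s] integral_complex_of_real X(2) ..
  then show "expectation (\<lambda>\<omega>. exp (of_real c * increment h k \<omega>)) = 1"
    by (simp flip: of_real_mult exp_add)
qed

text \<open>The semigroup property of the heat kernel, coordinate by coordinate.\<close>

lemma increment_heat_kernel:
  assumes h: "0 < h" and s: "0 < s"
  shows "(\<integral>\<^sup>+\<omega>. ennreal (heat_kernel s (z + increment h k \<omega>)) \<partial>M) = ennreal (heat_kernel (s + h) z)"
proof -
  have sq: "0 < sqrt s" "0 < sqrt h" using s h by auto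
  let ?n = "\<lambda>x. ennreal (normal_density 0 (sqrt s) x)"
  let ?X = "\<lambda>\<omega>. Re (increment h k \<omega>)" and ?Y = "\<lambda>\<omega>. Im (increment h k \<omega>)"
  note conv = normal_convolution[OF increment_components(1)[OF h] sq] normal_convolution[OF increment_components(2)[OF h] sq]
  have [measurable]: "increment h k \<in> borel_measurable M" by (rule increment_measurable[OF h])
  have "(\<integral>\<^sup>+\<omega>. ennreal (heat_kernel s (z + increment h k \<omega>)) \<partial>M)
      = (\<integral>\<^sup>+\<omega>. ?n (Re z + ?X \<omega>) * ?n (Im z + ?Y \<omega>) \<partial>M)"
    by (intro nn_integral_cong) (simp add: heat_kernel_eq_normal[OF s] ennreal_mult'')
  also have "\<dots> = (\<integral>\<^sup>+\<omega>. (\<integral>\<^sup>+\<omega>'. ?n (Re z + ?X \<omega>) * ?n (Im z + ?Y \<omega>') \<partial>M) \<partial>M)"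
    using indep_var_nn_integral_iterated[OF increment_components(3)[OF h, of k],
      of "\<lambda>(x, y). ?n (Re z + x) * ?n (Im z + y)"] by simp
  also have "\<dots> = ennreal (normal_density 0 (sqrt (s + h)) (Re z)) * ennreal (normal_density 0 (sqrt (s + h)) (Im z))"
    using s h by (simp add: nn_integral_cmult nn_integral_multc conv)
  also have "\<dots> = ennreal (heat_kernel (s + h) z)"
    using s h by (simp add: heat_kernel_eq_normal ennreal_mult'')
  finally show ?thesis .
qed

text \<open>A step of length \<open>h\<close> turns the heat kernel at time \<open>s\<close> into the one at time \<open>s + h\<close>. After the
  substitution \<open>s + h\<close> the discount \<open>exp (- s)\<close> has grown by \<open>exp h\<close>, and the times below \<open>h\<close> are lost.\<close>

lemma resolvent_kernel_increment:
  assumes h: "0 < h"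
  shows "(\<integral>\<^sup>+\<omega>. resolvent_kernel (z + increment h k \<omega>) \<partial>M) \<le> ennreal (exp h) * resolvent_kernel z"
proof -
  have [measurable]: "increment h k \<in> borel_measurable M" by (rule increment_measurable[OF h])
  interpret pair_sigma_finite M lborel ..
  let ?f = "\<lambda>s z. ennreal (exp (- s) * heat_kernel s z) * indicator {0<..} s"
  have "(\<integral>\<^sup>+\<omega>. resolvent_kernel (z + increment h k \<omega>) \<partial>M)
      = (\<integral>\<^sup>+s. (\<integral>\<^sup>+\<omega>. ?f s (z + increment h k \<omega>) \<partial>M) \<partial>lborel)"
    unfolding resolvent_kernel_def by (rule Fubini'[symmetric]) (simp add: heat_kernel_def split_beta)
  also have "\<dots> = (\<integral>\<^sup>+s. ennreal (exp (- s) * heat_kernel (s + h) z) * indicator {0<..} s \<partial>lborel)"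
  proof (intro nn_integral_cong)
    fix s :: real
    show "(\<integral>\<^sup>+\<omega>. ?f s (z + increment h k \<omega>) \<partial>M) = ennreal (exp (- s) * heat_kernel (s + h) z) * indicator {0<..} s"
    proof (cases "0 < s")
      case True
      have "(\<lambda>\<omega>. ennreal (heat_kernel s (z + increment h k \<omega>))) \<in> borel_measurable M"
        unfolding heat_kernel_def by measurable
      then have "(\<integral>\<^sup>+\<omega>. ennreal (exp (- s)) * ennreal (heat_kernel s (z + increment h k \<omega>)) \<partial>M)
         = ennreal (exp (- s)) * ennreal (heat_kernel (s + h) z)"
        by (subst nn_integral_cmult) (auto simp: increment_heat_kernel[OF h True])
      then show ?thesis using True by (simp add: ennreal_mult')
    qed simp
  qed
  also have "\<dots> \<le> (\<integral>\<^sup>+s. ennreal (exp h) * (ennreal (exp (- (h + 1 * s)) * heat_kernel (h + 1 * s) z) * indicator {0<..} (h + 1 * s)) \<partial>lborel)"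
    using h by (intro nn_integral_mono)
      (auto simp: indicator_def ennreal_mult'[symmetric] add.commute simp flip: exp_add mult.assoc)
  also have "\<dots> = ennreal (exp h) * resolvent_kernel z"
    unfolding resolvent_kernel_def
    by (subst (2) nn_integral_real_affine[where c=1 and t=h])
      (auto simp: heat_kernel_def intro!: nn_integral_cmult)
  finally show ?thesis .
qed

definition walk :: "complex set \<Rightarrow> real \<Rightarrow> nat \<Rightarrow> 'w \<Rightarrow> complex" where
  "walk U h n \<omega> = stopped_walk U a (\<lambda>i. increment h i \<omega>) n"

lemma walk_on_path:
  assumes "B 0 \<omega> = a"
  shows "\<exists>k\<le>n. walk U h n \<omega> = B (real k * h) \<omega> \<and> (\<forall>i<k. B (real i * h) \<omega> \<in> U) \<and> (B (real k * h) \<omega> \<notin> U \<or> k = n)"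
  using stopped_walk_partial_sum[of "\<lambda>i. B (real i * h) \<omega>" a "\<lambda>i. increment h i \<omega>" n U] assms
  by (simp add: walk_def increment_def)

context
  fixes U :: "complex set" and h :: real
  assumes U [measurable]: "U \<in> sets borel" and h: "0 < h"
begin

lemma walk_indep_increment: "indep_var borel (walk U h k) borel (increment h k)"
proof -
  have "indep_vars (\<lambda>_. borel) (\<lambda>i \<omega>. B (real (Suc i) * h) \<omega> - B (real i * h) \<omega>) {..<Suc k}"
    by (rule increments_indep[where \<tau>="\<lambda>i. real i * h"]) (use h in auto)
  then have "indep_vars (\<lambda>_. borel) (increment h) {..<Suc k}"
    unfolding increment_def[abs_def] .
  from indep_var_restrict[OF this, of "{..<k}" "{k}"]
  have "indep_var (PiM {..<k} (\<lambda>_. borel)) (\<lambda>\<omega>. \<lambda>i\<in>{..<k}. increment h i \<omega>)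
      (PiM {k} (\<lambda>_. borel)) (\<lambda>\<omega>. \<lambda>i\<in>{k}. increment h i \<omega>)" by auto
  from indep_var_compose[OF this stopped_walk_measurable[OF U, of k k a] measurable_component_singleton[of k]]
  have "indep_var borel ((\<lambda>d. stopped_walk U a d k) \<circ> (\<lambda>\<omega>. \<lambda>i\<in>{..<k}. increment h i \<omega>))
     borel ((\<lambda>d. d k) \<circ> (\<lambda>\<omega>. \<lambda>i\<in>{k}. increment h i \<omega>))" by simp
  moreover have "(\<lambda>d. stopped_walk U a d k) \<circ> (\<lambda>\<omega>. \<lambda>i\<in>{..<k}. increment h i \<omega>) = walk U h k"
    by (auto simp: fun_eq_iff walk_def intro!: stopped_walk_cong)
  moreover have "(\<lambda>d. d k) \<circ> (\<lambda>\<omega>. \<lambda>i\<in>{k}. increment h i \<omega>) = increment h k"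
    by (auto simp: fun_eq_iff)
  ultimately show ?thesis by simp
qed

lemma walk_measurable [measurable]: "walk U h k \<in> borel_measurable M"
  using walk_indep_increment by (rule indep_var_rv1)

lemma walk_Suc: "walk U h (Suc k) \<omega> = walk U h k \<omega> + (if walk U h k \<omega> \<in> U then increment h k \<omega> else 0)"
  by (simp add: walk_def)

lemma walk_resolvent_kernel:
  "(\<integral>\<^sup>+\<omega>. resolvent_kernel (walk U h n \<omega>) \<partial>M) \<le> ennreal (exp (real n * h)) * resolvent_kernel a"
proof (induction n)
  case 0
  then show ?case by (simp add: walk_def emeasure_space_1)
next
  case (Suc n)
  have [measurable]: "increment h n \<in> borel_measurable M" by (rule increment_measurable[OF h])
  let ?F = "\<lambda>(z, w). resolvent_kernel (z + (if z \<in> U then w else 0))"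
  have "(\<integral>\<^sup>+\<omega>. resolvent_kernel (walk U h (Suc n) \<omega>) \<partial>M) = (\<integral>\<^sup>+\<omega>. ?F (walk U h n \<omega>, increment h n \<omega>) \<partial>M)"
    by (simp add: walk_Suc)
  also have "\<dots> = (\<integral>\<^sup>+\<omega>. (\<integral>\<^sup>+\<omega>'. ?F (walk U h n \<omega>, increment h n \<omega>') \<partial>M) \<partial>M)"
    by (rule indep_var_nn_integral_iterated[OF walk_indep_increment]) measurable
  also have "\<dots> \<le> (\<integral>\<^sup>+\<omega>. ennreal (exp h) * resolvent_kernel (walk U h n \<omega>) \<partial>M)"
  proof (intro nn_integral_mono)
    fix \<omega>
    have "resolvent_kernel z \<le> ennreal (exp h) * resolvent_kernel z" for z
      using mult_right_mono[of 1 "ennreal (exp h)" "resolvent_kernel z"] h by simp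
    then show "(\<integral>\<^sup>+\<omega>'. ?F (walk U h n \<omega>, increment h n \<omega>') \<partial>M) \<le> ennreal (exp h) * resolvent_kernel (walk U h n \<omega>)"
      using resolvent_kernel_increment[OF h, of "walk U h n \<omega>" n] by (cases "walk U h n \<omega> \<in> U") (auto simp: emeasure_space_1)
  qed
  also have "\<dots> = ennreal (exp h) * (\<integral>\<^sup>+\<omega>. resolvent_kernel (walk U h n \<omega>) \<partial>M)"
    by (rule nn_integral_cmult) measurable
  also have "\<dots> \<le> ennreal (exp h) * (ennreal (exp (real n * h)) * resolvent_kernel a)"
    by (intro mult_left_mono Suc.IH) auto
  also have "\<dots> = ennreal (exp (real (Suc n) * h)) * resolvent_kernel a"
    by (simp add: algebra_simps exp_add ennreal_mult)
  finally show ?case .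
qed

text \<open>The square of \<open>\<bar>exp (c * z)\<bar>\<close> is \<open>exp (2 * c * Re z)\<close>, so this gives both the integrability of
  \<open>exp (c * z)\<close> along the walk and a second moment bound in which \<open>n\<close> and \<open>h\<close> enter only
  through the elapsed time \<open>n * h\<close>.\<close>

lemma walk_exp_Re:
  fixes c :: real
  shows "integrable M (\<lambda>\<omega>. exp (c * Re (walk U h n \<omega>)))
    \<and> expectation (\<lambda>\<omega>. exp (c * Re (walk U h n \<omega>))) \<le> exp (c\<^sup>2 * h / 2 * real n) * exp (c * Re a)"
proof (induction n)
  case 0
  then show ?case by (simp add: walk_def)
next
  case (Suc n)
  let ?D = "\<lambda>\<omega>. Re (increment h n \<omega>)" and ?g = "\<lambda>\<omega>. exp (c * Re (walk U h n \<omega>))"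
  have [measurable]: "increment h n \<in> borel_measurable M" by (rule increment_measurable[OF h])
  have s: "0 < sqrt h" using h by simp
  note D = normal_exp_moment[OF increment_components(1)[OF h] s, of c]
  have g: "integrable M ?g" using Suc by simp
  have g1: "integrable M (\<lambda>\<omega>. ?g \<omega> * indicator U (walk U h n \<omega>))"
    by (rule Bochner_Integration.integrable_bound[OF g]) (auto simp: indicator_def)
  have g2: "integrable M (\<lambda>\<omega>. ?g \<omega> * indicator (- U) (walk U h n \<omega>))"
    by (rule Bochner_Integration.integrable_bound[OF g]) (auto simp: indicator_def)
  have ind: "indep_var borel (\<lambda>\<omega>. ?g \<omega> * indicator U (walk U h n \<omega>)) borel (\<lambda>\<omega>. exp (c * ?D \<omega>))"
    using indep_var_compose[OF walk_indep_increment[of n],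
      of "\<lambda>z. exp (c * Re z) * indicator U z :: real" borel "\<lambda>z. exp (c * Re z)" borel] by (simp add: o_def)
  have split: "exp (c * Re (walk U h (Suc n) \<omega>)) = ?g \<omega> * indicator U (walk U h n \<omega>) * exp (c * ?D \<omega>) + ?g \<omega> * indicator (- U) (walk U h n \<omega>)" for \<omega>
    by (auto simp: walk_Suc indicator_def algebra_simps exp_add)
  note i = indep_var_integrable[OF ind g1 D(1)] and e = indep_var_lebesgue_integral[OF ind g1 D(1)]
  let ?K = "exp (c\<^sup>2 * (sqrt h)\<^sup>2 / 2)"
  have K1: "1 \<le> ?K" using h by simp
  have "expectation (\<lambda>\<omega>. exp (c * Re (walk U h (Suc n) \<omega>)))
     = expectation (\<lambda>\<omega>. ?g \<omega> * indicator U (walk U h n \<omega>)) * ?K + 1 * expectation (\<lambda>\<omega>. ?g \<omega> * indicator (- U) (walk U h n \<omega>))"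
    unfolding split by (subst Bochner_Integration.integral_add[OF i g2]) (simp add: e D(2))
  also have "\<dots> \<le> expectation (\<lambda>\<omega>. ?g \<omega> * indicator U (walk U h n \<omega>)) * ?K + ?K * expectation (\<lambda>\<omega>. ?g \<omega> * indicator (- U) (walk U h n \<omega>))"
    by (intro add_left_mono mult_right_mono K1 integral_nonneg) auto
  also have "\<dots> = ?K * expectation (\<lambda>\<omega>. ?g \<omega> * indicator U (walk U h n \<omega>) + ?g \<omega> * indicator (- U) (walk U h n \<omega>))"
    by (subst Bochner_Integration.integral_add[OF g1 g2]) (simp add: algebra_simps)
  also have "(\<lambda>\<omega>. ?g \<omega> * indicator U (walk U h n \<omega>) + ?g \<omega> * indicator (- U) (walk U h n \<omega>)) = ?g"
    by (auto simp: fun_eq_iff indicator_def)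
  also have "?K * expectation ?g \<le> ?K * (exp (c\<^sup>2 * h / 2 * real n) * exp (c * Re a))"
    using Suc by (intro mult_left_mono) auto
  also have "\<dots> = exp (c\<^sup>2 * h / 2 * real (Suc n)) * exp (c * Re a)"
    using h by (simp add: algebra_simps add_divide_distrib flip: exp_add)
  finally show ?case
    using Bochner_Integration.integrable_add[OF i g2] unfolding split by blast
qed

text \<open>Optional stopping for the martingale \<open>exp (c * z)\<close>, one step at a time: a step either leaves the
  walk where it is or multiplies by an independent factor of expectation \<open>1\<close>.\<close>

lemma walk_exp:
  fixes c :: real
  shows "integrable M (\<lambda>\<omega>. exp (of_real c * walk U h n \<omega>))"
    and "expectation (\<lambda>\<omega>. exp (of_real c * walk U h n \<omega>)) = exp (of_real c * a)"
proof -
  have int: "integrable M (\<lambda>\<omega>. exp (of_real c * walk U h n \<omega>))" for n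
    by (rule Bochner_Integration.integrable_bound[OF conjunct1[OF walk_exp_Re[of c n]]]) auto
  show "integrable M (\<lambda>\<omega>. exp (of_real c * walk U h n \<omega>))" by (rule int)
  show "expectation (\<lambda>\<omega>. exp (of_real c * walk U h n \<omega>)) = exp (of_real c * a)"
  proof (induction n)
    case 0
    then show ?case by (simp add: walk_def prob_space)
  next
    case (Suc n)
    let ?D = "\<lambda>\<omega>. exp (of_real c * increment h n \<omega>)" and ?g = "\<lambda>\<omega>. exp (of_real c * walk U h n \<omega>)"
    have [measurable]: "increment h n \<in> borel_measurable M" by (rule increment_measurable[OF h])
    note D = increment_exp[OF h, of c n]
    have g1: "integrable M (\<lambda>\<omega>. ?g \<omega> * indicator U (walk U h n \<omega>))"
      by (rule Bochner_Integration.integrable_bound[OF int[of n]]) (auto simp: indicator_def)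
    have g2: "integrable M (\<lambda>\<omega>. ?g \<omega> * indicator (- U) (walk U h n \<omega>))"
      by (rule Bochner_Integration.integrable_bound[OF int[of n]]) (auto simp: indicator_def)
    have ind: "indep_var borel (\<lambda>\<omega>. ?g \<omega> * indicator U (walk U h n \<omega>)) borel ?D"
      using indep_var_compose[OF walk_indep_increment[of n],
        of "\<lambda>z. exp (of_real c * z) * indicator U z :: complex" borel "\<lambda>z. exp (of_real c * z)" borel]
      by (simp add: o_def)
    have split: "exp (of_real c * walk U h (Suc n) \<omega>) = ?g \<omega> * indicator U (walk U h n \<omega>) * ?D \<omega> + ?g \<omega> * indicator (- U) (walk U h n \<omega>)" for \<omega>
      by (auto simp: walk_Suc indicator_def algebra_simps exp_add)
    note i = indep_var_integrable[OF ind g1 D(1)] and e = indep_var_lebesgue_integral[OF ind g1 D(1)]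
    have "expectation (\<lambda>\<omega>. exp (of_real c * walk U h (Suc n) \<omega>))
      = expectation (\<lambda>\<omega>. ?g \<omega> * indicator U (walk U h n \<omega>)) + expectation (\<lambda>\<omega>. ?g \<omega> * indicator (- U) (walk U h n \<omega>))"
      unfolding split by (subst Bochner_Integration.integral_add[OF i g2]) (simp add: e D(2))
    also have "\<dots> = expectation (\<lambda>\<omega>. ?g \<omega> * indicator U (walk U h n \<omega>) + ?g \<omega> * indicator (- U) (walk U h n \<omega>))"
      by (rule Bochner_Integration.integral_add[OF g1 g2, symmetric])
    also have "(\<lambda>\<omega>. ?g \<omega> * indicator U (walk U h n \<omega>) + ?g \<omega> * indicator (- U) (walk U h n \<omega>)) = ?g"
      by (auto simp: fun_eq_iff indicator_def)
    finally show ?case using Suc by simp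
  qed
qed

end
end

section \<open>The path avoids the origin and leaves the disc\<close>

text \<open>The approximating grid time is taken below \<open>t\<close>: just after an exit time the
  path may be back inside, and in an interval \<open>{0..q}\<close> the grid time must stay inside.\<close>

lemma dyadic_approx:
  fixes X :: "real \<Rightarrow> 'a :: metric_space"
  assumes X: "continuous_on {0..} X" and t: "0 \<le> t" and e: "0 < e"
  shows "\<forall>\<^sub>F m in sequentially. real (nat \<lfloor>t * 2 ^ m\<rfloor>) * (1/2) ^ m \<le> t \<and> dist (X (real (nat \<lfloor>t * 2 ^ m\<rfloor>) * (1/2) ^ m)) (X t) < e"
proof -
  obtain d where d: "d > 0" "\<And>s. 0 \<le> s \<Longrightarrow> dist s t < d \<Longrightarrow> dist (X s) (X t) < e"
    using X t e unfolding continuous_on_iff by (metis atLeast_iff)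
  have "\<forall>\<^sub>F m in sequentially. (1/2 :: real) ^ m < d"
    by (rule order_tendstoD(2)[OF LIMSEQ_power_zero d(1)]) simp
  then show ?thesis
  proof eventually_elim
    case (elim m)
    define s where "s = real (nat \<lfloor>t * 2 ^ m\<rfloor>) * (1/2) ^ m"
    have fl: "real (nat \<lfloor>t * 2 ^ m\<rfloor>) = of_int \<lfloor>t * 2 ^ m\<rfloor>" using t by simp
    have "of_int \<lfloor>t * 2 ^ m\<rfloor> * (1/2 :: real) ^ m \<le> t * 2 ^ m * (1/2) ^ m"
      by (intro mult_right_mono) auto
    then have 1: "s \<le> t" by (simp add: s_def fl mult.assoc flip: power_mult_distrib)
    have "t * 2 ^ m * (1/2) ^ m < (of_int \<lfloor>t * 2 ^ m\<rfloor> + 1) * (1/2 :: real) ^ m"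
      by (intro mult_strict_right_mono) (linarith, simp)
    then have 2: "t < s + (1/2) ^ m" by (simp add: s_def fl mult.assoc distrib_right flip: power_mult_distrib)
    have "dist s t < d" using 1 2 elim by (simp add: dist_real_def)
    moreover have "0 \<le> s" by (simp add: s_def)
    ultimately show ?case using 1 d(2) unfolding s_def by blast
  qed
qed

context planar_brownian_motion
begin

text \<open>Markov's inequality for the resolvent kernel along the walk frozen in the ball of radius \<open>\<epsilon>\<close>. The
  bound on the right does not depend on the mesh.\<close>

lemma emeasure_near_zero:
  fixes N m :: nat
  assumes \<epsilon>: "0 < \<epsilon>" "\<epsilon> \<le> 1"
  defines "A \<equiv> {\<omega>\<in>space M. \<exists>k\<le>N * 2 ^ m. cmod (B (real k * (1/2) ^ m) \<omega>) < \<epsilon>}"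
  shows "ennreal (exp (- 3 / 2) / pi * ln (1 / \<epsilon>)) * emeasure M A \<le> ennreal (exp (real N)) * resolvent_kernel a"
proof -
  define U where "U = {z. \<epsilon> \<le> cmod z}"
  define h :: real where "h = (1/2) ^ m"
  define n where "n = N * 2 ^ m"
  have nh: "real n * h = real N" by (simp add: n_def h_def mult.assoc flip: power_mult_distrib)
  have h: "0 < h" by (simp add: h_def)
  have U [measurable]: "U \<in> sets borel" unfolding U_def by measurable
  have Bm: "B (real k * h) \<in> borel_measurable M" for k using h by (intro random_variable) simp
  have A [measurable]: "A \<in> sets M"
    unfolding A_def h_def[symmetric] n_def[symmetric] using Bm by measurable
  let ?c = "ennreal (exp (- 3 / 2) / pi * ln (1 / \<epsilon>))"
  have "?c * emeasure M A = (\<integral>\<^sup>+\<omega>. ?c * indicator A \<omega> \<partial>M)"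
    by (simp add: nn_integral_cmult)
  also have "\<dots> \<le> (\<integral>\<^sup>+\<omega>. resolvent_kernel (walk U h n \<omega>) \<partial>M)"
  proof (rule nn_integral_mono_AE)
    show "AE \<omega> in M. ?c * indicator A \<omega> \<le> resolvent_kernel (walk U h n \<omega>)"
      using start
    proof eventually_elim
      case (elim \<omega>)
      have "cmod (walk U h n \<omega>) < \<epsilon>" if \<omega>: "\<omega> \<in> A"
      proof -
        obtain k where k: "k \<le> n" "walk U h n \<omega> = B (real k * h) \<omega>"
          "\<forall>i<k. B (real i * h) \<omega> \<in> U" "B (real k * h) \<omega> \<notin> U \<or> k = n"
          using walk_on_path[OF elim] by blast
        obtain l where l: "l \<le> n" "B (real l * h) \<omega> \<notin> U"
          using \<omega> by (auto simp: A_def U_def h_def n_def not_le)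
        then have "k \<le> l" using k(3) by (meson not_le)
        then have "B (real k * h) \<omega> \<notin> U" using k(4) l by auto
        then show ?thesis using k(2) by (simp add: U_def)
      qed
      then show ?case using resolvent_kernel_ge[of "walk U h n \<omega>" \<epsilon>] \<epsilon> by (auto simp: indicator_def)
    qed
  qed
  also have "\<dots> \<le> ennreal (exp (real N)) * resolvent_kernel a"
    using walk_resolvent_kernel[OF U h, of n] by (simp only: nh)
  finally show ?thesis .
qed

text \<open>A path that visits \<open>0\<close> enters every ball around \<open>0\<close> at grid times, for all fine enough meshes. The
  probability of the latter is at most a constant divided by \<open>ln (1 / \<epsilon>)\<close>.\<close>

theorem never_hits_zero:
  assumes a: "a \<noteq> 0"
  shows "AE \<omega> in M. \<forall>t\<ge>0. B t \<omega> \<noteq> 0"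
proof -
  have "AE \<omega> in M. \<forall>t\<ge>0. t \<le> real N \<longrightarrow> B t \<omega> \<noteq> 0" for N
  proof -
    define A where "A \<epsilon> m = {\<omega>\<in>space M. \<exists>k\<le>N * 2 ^ m. cmod (B (real k * (1/2) ^ m) \<omega>) < \<epsilon>}" for \<epsilon> :: real and m
    have Bm: "B (real k * (1/2) ^ m) \<in> borel_measurable M" for k m by (intro random_variable) simp
    have [measurable]: "A \<epsilon> m \<in> sets M" for \<epsilon> m unfolding A_def using Bm by measurable
    define L where "L \<epsilon> = (\<Union>i. \<Inter>m\<in>{i..}. A \<epsilon> m)" for \<epsilon>
    have [measurable]: "L \<epsilon> \<in> sets M" for \<epsilon> unfolding L_def by measurable
    define K where "K = enn2real (ennreal (exp (real N)) * resolvent_kernel a)"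
    have K: "ennreal (exp (real N)) * resolvent_kernel a = ennreal K"
      using resolvent_kernel_finite[OF a] unfolding K_def
      by (intro ennreal_enn2real[symmetric]) (auto simp: ennreal_mult_less_top)
    have K0: "0 \<le> K" by (simp add: K_def)
    let ?c = "\<lambda>\<epsilon>. exp (- 3 / 2) / pi * ln (1 / \<epsilon>)"
    have L: "?c \<epsilon> * measure M (L \<epsilon>) \<le> K" if \<epsilon>: "0 < \<epsilon>" "\<epsilon> \<le> 1" for \<epsilon>
    proof -
      have c: "0 \<le> ?c \<epsilon>" using \<epsilon> by simp
      have lim: "(\<lambda>i. measure M (\<Inter>m\<in>{i..}. A \<epsilon> m)) \<longlonglongrightarrow> measure M (L \<epsilon>)"
        unfolding L_def by (rule finite_Lim_measure_incseq) (auto simp: incseq_def)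
      have bd: "?c \<epsilon> * measure M (\<Inter>m\<in>{i..}. A \<epsilon> m) \<le> K" for i
      proof -
        have "measure M (\<Inter>m\<in>{i..}. A \<epsilon> m) \<le> measure M (A \<epsilon> i)"
          by (intro finite_measure_mono) auto
        then have "?c \<epsilon> * measure M (\<Inter>m\<in>{i..}. A \<epsilon> m) \<le> ?c \<epsilon> * measure M (A \<epsilon> i)"
          using c by (rule mult_left_mono)
        moreover have "ennreal (?c \<epsilon> * measure M (A \<epsilon> i)) \<le> ennreal K"
          using emeasure_near_zero[OF \<epsilon>, of N i] c
          unfolding A_def[symmetric] K emeasure_eq_measure by (simp only: ennreal_mult[symmetric] measure_nonneg)
        ultimately show ?thesis using K0 by (simp add: ennreal_le_iff)
      qed
      show ?thesis
        by (rule LIMSEQ_le_const2[OF tendsto_mult_left[OF lim]]) (use bd in auto)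
    qed
    define Z where "Z = (\<Inter>i. L (inverse (real (Suc i))))"
    have [measurable]: "Z \<in> sets M" unfolding Z_def by measurable
    have "measure M Z = 0"
    proof (rule ccontr)
      assume "measure M Z \<noteq> 0"
      then have mp: "measure M Z > 0" by (simp add: zero_less_measure_iff)
      have "?c (inverse (real (Suc i))) * measure M Z \<le> K" for i
      proof -
        have "measure M Z \<le> measure M (L (inverse (real (Suc i))))"
          unfolding Z_def by (intro finite_measure_mono) auto
        then have "?c (inverse (real (Suc i))) * measure M Z \<le> ?c (inverse (real (Suc i))) * measure M (L (inverse (real (Suc i))))"
          by (intro mult_left_mono) (auto simp: inverse_eq_divide)
        also have "\<dots> \<le> K" by (rule L) (auto simp: field_simps)
        finally show ?thesis .
      qed
      then have bd: "ln (real (Suc i)) \<le> K / (exp (- 3 / 2) / pi * measure M Z)" for i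
        using mp by (simp add: field_simps)
      have "filterlim (\<lambda>i. ln (real (Suc i))) at_top sequentially"
        by (intro filterlim_compose[OF ln_at_top] filterlim_compose[OF filterlim_real_sequentially] filterlim_Suc)
      then obtain i where "K / (exp (- 3 / 2) / pi * measure M Z) < ln (real (Suc i))"
        unfolding filterlim_at_top_dense by (meson eventually_happens trivial_limit_sequentially)
      with bd[of i] show False by simp
    qed
    then have "Z \<in> null_sets M" by (auto simp: null_sets_def emeasure_eq_measure)
    moreover have "{\<omega>\<in>space M. \<not> (\<forall>t\<ge>0. t \<le> real N \<longrightarrow> B t \<omega> \<noteq> 0)} \<subseteq> Z"
    proof
      fix \<omega> assume "\<omega> \<in> {\<omega>\<in>space M. \<not> (\<forall>t\<ge>0. t \<le> real N \<longrightarrow> B t \<omega> \<noteq> 0)}"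
      then obtain t where \<omega>: "\<omega> \<in> space M" and t: "0 \<le> t" "t \<le> real N" "B t \<omega> = 0" by auto
      show "\<omega> \<in> Z" unfolding Z_def
      proof (rule INT_I)
        fix i :: nat
        have "0 < inverse (real (Suc i))" by simp
        from dyadic_approx[OF continuous_paths[OF \<omega>] t(1) this]
        have "\<forall>\<^sub>F m in sequentially. \<omega> \<in> A (inverse (real (Suc i))) m"
        proof (rule eventually_mono)
          fix m
          let ?k = "nat \<lfloor>t * 2 ^ m\<rfloor>"
          assume *: "real ?k * (1/2) ^ m \<le> t \<and> dist (B (real ?k * (1/2) ^ m) \<omega>) (B t \<omega>) < inverse (real (Suc i))"
          have "t * 2 ^ m \<le> real (N * 2 ^ m)" using t by simp
          then have "?k \<le> N * 2 ^ m"
            by (metis floor_mono floor_of_nat nat_int nat_mono)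
          then show "\<omega> \<in> A (inverse (real (Suc i))) m" using * \<omega> t(3) by (auto simp: A_def)
        qed
        then show "\<omega> \<in> L (inverse (real (Suc i)))"
          by (auto simp: L_def eventually_sequentially)
      qed
    qed
    ultimately show ?thesis by (rule AE_I')
  qed
  then have "AE \<omega> in M. \<forall>N. \<forall>t\<ge>0. t \<le> real N \<longrightarrow> B t \<omega> \<noteq> 0"
    by (simp add: AE_all_countable)
  then show ?thesis
    by eventually_elim (meson real_arch_simple)
qed

text \<open>While the path stays in the disc, the displacement of its real part up to time \<open>n\<close> is below \<open>2\<close>.
  As the variance \<open>n\<close> grows, this becomes arbitrarily unlikely.\<close>

lemma leaves_disc: "AE \<omega> in M. \<exists>t\<ge>0. 1 \<le> cmod (B t \<omega>)"
proof -
  define S where "S = {\<omega>\<in>space M. \<forall>n\<in>{1..}. \<bar>Re (B (real n) \<omega> - B 0 \<omega>)\<bar> < 2}"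
  have [measurable]: "B (real n) \<in> borel_measurable M" "B 0 \<in> borel_measurable M" for n
    by (auto intro: random_variable)
  have [measurable]: "S \<in> sets M" unfolding S_def by measurable
  have bd: "measure M S \<le> 4 / sqrt (2 * pi * real n)" if n: "n \<ge> 1" for n
  proof -
    let ?X = "\<lambda>\<omega>. Re (B (real n) \<omega> - B 0 \<omega>)"
    have "distributed M lborel ?X (normal_density 0 (sqrt (real n)))"
      using increment_Re[of 0 "real n"] n by simp
    then have "emeasure M (?X -` {-2..2} \<inter> space M)
        = (\<integral>\<^sup>+x. ennreal (normal_density 0 (sqrt (real n)) x) * indicator {-2..2} x \<partial>lborel)"
      by (rule distributed_emeasure) simp
    also have "\<dots> \<le> (\<integral>\<^sup>+x. ennreal (1 / sqrt (2 * pi * real n)) * indicator {-2..2::real} x \<partial>lborel)"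
      by (intro nn_integral_mono mult_right_mono ennreal_leI)
        (auto simp: normal_density_def intro!: divide_right_mono)
    also have "\<dots> = ennreal (4 / sqrt (2 * pi * real n))"
      by (subst nn_integral_cmult) (auto simp flip: ennreal_mult' ennreal_numeral)
    finally have "emeasure M (?X -` {-2..2} \<inter> space M) \<le> ennreal (4 / sqrt (2 * pi * real n))" .
    moreover have "emeasure M S \<le> emeasure M (?X -` {-2..2} \<inter> space M)"
      using n by (intro emeasure_mono) (auto simp: S_def abs_less_iff dest!: bspec[of _ _ n])
    ultimately have "ennreal (measure M S) \<le> ennreal (4 / sqrt (2 * pi * real n))"
      by (simp add: emeasure_eq_measure)
    then show ?thesis by (simp add: ennreal_le_iff)
  qed
  have "(\<lambda>n. 4 / sqrt (2 * pi * real n)) \<longlonglongrightarrow> 0" by real_asymp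
  then have "measure M S \<le> 0"
    by (rule LIMSEQ_le_const) (use bd in auto)
  then have "S \<in> null_sets M" by (auto simp: null_sets_def emeasure_eq_measure measure_le_0_iff)
  moreover have "{\<omega>\<in>space M. \<not> (\<exists>t\<ge>0. 1 \<le> cmod (B t \<omega>))} \<subseteq> S"
  proof safe
    fix \<omega> assume \<omega>: "\<omega> \<in> space M" "\<not> (\<exists>t\<ge>0. 1 \<le> cmod (B t \<omega>))"
    have "\<bar>Re (B (real n) \<omega> - B 0 \<omega>)\<bar> < 2" for n
    proof -
      have "\<bar>Re (B (real n) \<omega> - B 0 \<omega>)\<bar> \<le> cmod (B (real n) \<omega> - B 0 \<omega>)" by (rule abs_Re_le_cmod)
      also have "\<dots> \<le> cmod (B (real n) \<omega>) + cmod (B 0 \<omega>)" by (rule norm_triangle_ineq4)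
      also have "\<dots> < 2" using \<omega>(2) by (metis add_strict_mono not_le of_nat_0_le_iff one_add_one order_refl)
      finally show ?thesis .
    qed
    then show "\<omega> \<in> S" using \<omega>(1) by (simp add: S_def)
  qed
  ultimately show ?thesis by (rule AE_I')
qed

end

section \<open>Exit time and exit point\<close>

text \<open>By compactness of \<open>{0..q}\<close>, a path meets a closed set iff it comes arbitrarily close to it
  at grid times. The
  right-hand side is a countable combination of events, which makes exit times measurable.\<close>

lemma hits_closed_iff_dyadic:
  fixes X :: "real \<Rightarrow> 'a :: metric_space"
  assumes X: "continuous_on {0..} X" and F: "closed F" "F \<noteq> {}" and q: "0 \<le> q"
  shows "(\<exists>t. 0 \<le> t \<and> t \<le> q \<and> X t \<in> F) \<longleftrightarrow>
    (\<forall>n. \<exists>m k. real k * (1/2) ^ m \<le> q \<and> infdist (X (real k * (1/2) ^ m)) F < inverse (real (Suc n)))"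
    (is "?L \<longleftrightarrow> ?R")
proof
  assume ?L
  then obtain t where t: "0 \<le> t" "t \<le> q" "X t \<in> F" by blast
  show ?R
  proof
    fix n
    have "0 < inverse (real (Suc n))" by simp
    from eventually_happens'[OF _ dyadic_approx[OF X t(1) this]] obtain m where
      m: "real (nat \<lfloor>t * 2 ^ m\<rfloor>) * (1/2) ^ m \<le> t"
        "dist (X (real (nat \<lfloor>t * 2 ^ m\<rfloor>) * (1/2) ^ m)) (X t) < inverse (real (Suc n))" by auto
    let ?s = "real (nat \<lfloor>t * 2 ^ m\<rfloor>) * (1/2) ^ m"
    have "infdist (X ?s) F \<le> dist (X ?s) (X t)" by (rule infdist_le[OF t(3)])
    then have "?s \<le> q \<and> infdist (X ?s) F < inverse (real (Suc n))" using m t(2) by linarith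
    then show "\<exists>m k. real k * (1/2) ^ m \<le> q \<and> infdist (X (real k * (1/2) ^ m)) F < inverse (real (Suc n))" by blast
  qed
next
  assume R: ?R
  have "continuous_on {0..q} (\<lambda>t. infdist (X t) F)"
    by (intro continuous_on_infdist continuous_on_subset[OF X]) auto
  from continuous_attains_inf[OF _ _ this] q
  obtain t where t: "0 \<le> t" "t \<le> q" "\<And>s. 0 \<le> s \<Longrightarrow> s \<le> q \<Longrightarrow> infdist (X t) F \<le> infdist (X s) F"
    by (auto simp: Ball_def)
  have "infdist (X t) F \<le> 0"
  proof (rule ccontr)
    assume "\<not> infdist (X t) F \<le> 0"
    then obtain n where n: "inverse (real (Suc n)) < infdist (X t) F"
      using reals_Archimedean by (metis not_le)
    from R obtain m k where "real k * (1/2) ^ m \<le> q" "infdist (X (real k * (1/2) ^ m)) F < inverse (real (Suc n))" by blast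
    moreover from this have "infdist (X t) F \<le> infdist (X (real k * (1/2) ^ m)) F" by (intro t(3)) auto
    ultimately show False using n by linarith
  qed
  then have "X t \<in> F" using F infdist_nonneg[of "X t" F] by (metis antisym in_closed_iff_infdist_zero)
  then show ?L using t by blast
qed

context planar_brownian_motion
begin

lemma exit_time_measurable:
  assumes U: "open U" "U \<noteq> UNIV"
  shows "exit_time B U \<in> borel_measurable M"
  unfolding borel_measurable_ereal_iff_Iio
proof
  fix c :: ereal
  have F: "closed (- U)" "- U \<noteq> {}" using U by auto
  define H where "H q = {\<omega>\<in>space M. \<forall>n. \<exists>m k. real k * (1/2) ^ m \<le> q \<and>
      infdist (B (real k * (1/2) ^ m) \<omega>) (- U) < inverse (real (Suc n))}" for q :: real
  have Bm [measurable]: "B (real k * (1/2) ^ m) \<in> borel_measurable M" for k m by (intro random_variable) simp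
  have [measurable]: "(\<lambda>\<omega>. infdist (B (real k * (1/2) ^ m) \<omega>) (- U)) \<in> borel_measurable M" for k m
    by (rule measurable_compose[OF Bm borel_measurable_continuous_onI]) (intro continuous_intros)
  have H [measurable]: "H q \<in> sets M" for q unfolding H_def by measurable
  have "exit_time B U -` {..<c} \<inter> space M = (\<Union>q\<in>{q\<in>\<rat>. 0 \<le> q \<and> ereal q < c}. H q)"
  proof (intro set_eqI iffI)
    fix \<omega> assume "\<omega> \<in> exit_time B U -` {..<c} \<inter> space M"
    then have \<omega>: "\<omega> \<in> space M" and "exit_time B U \<omega> < c" by auto
    then obtain t where t: "0 \<le> t" "B t \<omega> \<notin> U" "ereal t < c"
      unfolding exit_time_def INF_less_iff by auto
    obtain q where q: "q \<in> \<rat>" "t \<le> q" "ereal q < c"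
    proof -
      obtain z where z: "t < z" "ereal z < c" using ereal_dense2[OF t(3)] by auto
      obtain q where "q \<in> \<rat>" "t < q" "q < z" using Rats_dense_in_real[OF z(1)] by blast
      then have "ereal q < ereal z" by simp
      then show ?thesis using that \<open>q \<in> \<rat>\<close> \<open>t < q\<close> z(2) by (meson less_imp_le order.strict_trans)
    qed
    have "\<omega> \<in> H q" using hits_closed_iff_dyadic[OF continuous_paths[OF \<omega>] F, of q] t q \<omega>
      unfolding H_def by auto
    then show "\<omega> \<in> (\<Union>q\<in>{q\<in>\<rat>. 0 \<le> q \<and> ereal q < c}. H q)"
      using q t by auto
  next
    fix \<omega> assume *: "\<omega> \<in> (\<Union>q\<in>{q\<in>\<rat>. 0 \<le> q \<and> ereal q < c}. H q)"
    then have \<omega>: "\<omega> \<in> space M" by (auto simp: H_def)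
    have "\<exists>t\<ge>0. B t \<omega> \<notin> U \<and> ereal t < c"
    proof -
      from * obtain q where q: "0 \<le> q" "ereal q < c" "\<omega> \<in> H q" by blast
      then obtain t where "0 \<le> t" "t \<le> q" "B t \<omega> \<in> - U"
        using hits_closed_iff_dyadic[OF continuous_paths[OF \<omega>] F, of q] unfolding H_def by auto
      moreover have "ereal t < c" using \<open>t \<le> q\<close> q(2) by (meson ereal_less_eq(3) le_less_trans)
      ultimately show ?thesis by auto
    qed
    then show "\<omega> \<in> exit_time B U -` {..<c} \<inter> space M"
      using \<omega> unfolding exit_time_def vimage_def INF_less_iff by (auto simp: INF_less_iff)
  qed
  moreover have cq: "countable {q\<in>\<rat>. 0 \<le> q \<and> ereal q < c}"
    by (rule countable_subset[OF _ countable_rat]) auto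
  moreover have "(\<Union>q\<in>{q\<in>\<rat>. 0 \<le> q \<and> ereal q < c}. H q) \<in> sets M"
    by (rule sets.countable_UN'[OF cq]) (use H in auto)
  ultimately show "exit_time B U -` {..<c} \<inter> space M \<in> sets M"
    by simp
qed

text \<open>The path at the random exit time is the limit of the path at the exit time rounded down to the
  grid, and the rounded times take countably many values.\<close>

lemma exit_point_measurable:
  assumes U: "open U" "U \<noteq> UNIV"
  shows "exit_point B U \<in> borel_measurable M"
proof -
  define \<tau> where "\<tau> \<omega> = real_of_ereal (exit_time B U \<omega>)" for \<omega>
  have [measurable]: "\<tau> \<in> borel_measurable M"
    unfolding \<tau>_def using exit_time_measurable[OF U] by measurable
  have \<tau>0: "0 \<le> \<tau> \<omega>" for \<omega>
    unfolding \<tau>_def exit_time_def by (intro real_of_ereal_pos INF_greatest) auto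
  have Bm: "B (real k * (1/2) ^ m) \<in> borel_measurable M" for k m by (intro random_variable) simp
  show ?thesis
  proof (rule borel_measurable_LIMSEQ_metric)
    fix m
    show "(\<lambda>\<omega>. B (real (nat \<lfloor>\<tau> \<omega> * 2 ^ m\<rfloor>) * (1/2) ^ m) \<omega>) \<in> borel_measurable M"
      by (rule measurable_compose_countable[where f="\<lambda>k \<omega>. B (real k * (1/2) ^ m) \<omega>" and g="\<lambda>\<omega>. nat \<lfloor>\<tau> \<omega> * 2 ^ m\<rfloor>"])
        (use Bm in measurable)
  next
    fix \<omega> assume \<omega>: "\<omega> \<in> space M"
    show "(\<lambda>m. B (real (nat \<lfloor>\<tau> \<omega> * 2 ^ m\<rfloor>) * (1/2) ^ m) \<omega>) \<longlonglongrightarrow> exit_point B U \<omega>"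
      unfolding tendsto_iff exit_point_def \<tau>_def[symmetric]
    proof (intro allI impI)
      fix e :: real assume "0 < e"
      from dyadic_approx[OF continuous_paths[OF \<omega>] \<tau>0[of \<omega>] this]
      show "\<forall>\<^sub>F m in sequentially. dist (B (real (nat \<lfloor>\<tau> \<omega> * 2 ^ m\<rfloor>) * (1/2) ^ m) \<omega>) (B (\<tau> \<omega>) \<omega>) < e"
        by (rule eventually_mono) simp
    qed
  qed
qed

end

lemma punctured_disc_open:
  fixes V :: "complex set"
  assumes "V = {z. 0 < cmod z \<and> cmod z < 1}"
  shows "open V" "V \<noteq> UNIV"
  unfolding assms
  by (intro open_Collect_conj open_Collect_less continuous_intros)
    (auto simp: set_eq_iff intro!: exI[of _ 0])

text \<open>A path without zeros leaves the punctured disc when it first reaches the unit circle.\<close>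

lemma exit_time_punctured_disc:
  assumes X: "continuous_on {0..} (\<lambda>t. B t \<omega>)" and "cmod (B 0 \<omega>) < 1"
    and nz: "\<And>t. 0 \<le> t \<Longrightarrow> B t \<omega> \<noteq> 0" and ex: "\<exists>t\<ge>0. 1 \<le> cmod (B t \<omega>)"
  defines "\<tau> \<equiv> real_of_ereal (exit_time B {z. 0 < cmod z \<and> cmod z < 1} \<omega>)"
  shows "exit_time B {z. 0 < cmod z \<and> cmod z < 1} \<omega> = ereal \<tau>" "0 \<le> \<tau>" "cmod (B \<tau> \<omega>) = 1"
    and "\<And>s. 0 \<le> s \<Longrightarrow> s < \<tau> \<Longrightarrow> cmod (B s \<omega>) < 1"
proof -
  let ?V = "{z. 0 < cmod z \<and> cmod z < 1}"
  define S where "S = {t. 0 \<le> t \<and> B t \<omega> \<notin> ?V}"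
  have S: "S = {t\<in>{0..}. 1 \<le> cmod (B t \<omega>)}" unfolding S_def using nz by (auto simp: not_less)
  have "closed S" unfolding S
    by (rule continuous_on_closed_Collect_le) (auto intro!: continuous_intros X)
  moreover have "S \<noteq> {}" using ex by (auto simp: S)
  moreover have bdd: "bdd_below S" by (auto simp: S bdd_below_def)
  ultimately have inS: "Inf S \<in> S" using closed_contains_Inf by blast
  have "exit_time B ?V \<omega> = (INF t\<in>S. ereal t)" by (simp add: exit_time_def S_def)
  also have "\<dots> = ereal (Inf S)"
    by (intro antisym INF_lower inS INF_greatest) (auto intro: cInf_lower bdd)
  finally have e: "exit_time B ?V \<omega> = ereal (Inf S)" .
  then have \<tau>: "\<tau> = Inf S" by (simp add: \<tau>_def)
  show "exit_time B ?V \<omega> = ereal \<tau>" using e \<tau> by simp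
  show \<tau>0: "0 \<le> \<tau>" using inS by (simp add: \<tau> S)
  show lt: "cmod (B s \<omega>) < 1" if "0 \<le> s" "s < \<tau>" for s
    using that cInf_lower[OF _ bdd, of s] by (fastforce simp: \<tau> S)
  have ge: "1 \<le> cmod (B \<tau> \<omega>)" using inS by (simp add: \<tau> S)
  have "continuous_on {0..\<tau>} (\<lambda>t. cmod (B t \<omega>))"
    by (intro continuous_intros continuous_on_subset[OF X]) auto
  from IVT'[OF _ ge \<tau>0 this] obtain s where s: "0 \<le> s" "s \<le> \<tau>" "cmod (B s \<omega>) = 1"
    using assms(2) by auto
  then show "cmod (B \<tau> \<omega>) = 1" using lt[of s] by (cases "s = \<tau>") auto
qed

text \<open>Before the exit time a path is close to the circle only when it is close to its exit point: away
  from the exit point, the modulus attains a maximum below \<open>1\<close>.\<close>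

lemma first_exit_continuity:
  fixes X :: "real \<Rightarrow> complex"
  assumes X: "continuous_on {0..} X" and \<tau>: "0 \<le> \<tau>" and lt: "\<And>s. 0 \<le> s \<Longrightarrow> s < \<tau> \<Longrightarrow> cmod (X s) < 1"
    and e: "0 < e"
  shows "\<exists>r0<1. \<forall>s. 0 \<le> s \<longrightarrow> s \<le> \<tau> \<longrightarrow> r0 \<le> cmod (X s) \<longrightarrow> dist (X s) (X \<tau>) < e"
proof -
  have Xc: "continuous_on {0..\<tau>} X" by (rule continuous_on_subset[OF X]) auto
  define K where "K = {s\<in>{0..\<tau>}. e \<le> dist (X s) (X \<tau>)}"
  have "closed K" unfolding K_def
    by (rule continuous_on_closed_Collect_le) (auto intro!: continuous_intros Xc)
  moreover have "bounded K" by (rule bounded_subset[of "{0..\<tau>}"]) (auto simp: K_def)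
  ultimately have "compact K" by (simp add: compact_eq_bounded_closed)
  show ?thesis
  proof (cases "K = {}")
    case True
    have "dist (X s) (X \<tau>) < e" if "0 \<le> s" "s \<le> \<tau>" for s
    proof (rule ccontr)
      assume "\<not> dist (X s) (X \<tau>) < e"
      then have "s \<in> K" using that by (simp add: K_def)
      with True show False by simp
    qed
    then show ?thesis by (intro exI[of _ 0]) auto
  next
    case False
    have "continuous_on K (\<lambda>s. cmod (X s))"
      by (intro continuous_intros continuous_on_subset[OF Xc]) (auto simp: K_def)
    from continuous_attains_sup[OF \<open>compact K\<close> False this]
    obtain s0 where s0: "s0 \<in> K" "\<And>s. s \<in> K \<Longrightarrow> cmod (X s) \<le> cmod (X s0)" by blast
    have "s0 \<noteq> \<tau>" using s0(1) e by (auto simp: K_def)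
    then have "cmod (X s0) < 1" using s0(1) by (intro lt) (auto simp: K_def)
    moreover have "dist (X s) (X \<tau>) < e" if "0 \<le> s" "s \<le> \<tau>" "(cmod (X s0) + 1) / 2 \<le> cmod (X s)" for s
    proof (rule ccontr)
      assume "\<not> dist (X s) (X \<tau>) < e"
      then have "s \<in> K" using that by (simp add: K_def)
      then show False using s0(2)[of s] that \<open>cmod (X s0) < 1\<close> by simp
    qed
    ultimately show ?thesis by (intro exI[of _ "(cmod (X s0) + 1) / 2"]) auto
  qed
qed

section \<open>Exponential moments of the exit point\<close>

context planar_brownian_motion
begin

text \<open>Let \<open>W j\<close> be the walk frozen outside the ball of radius \<open>r j < 1\<close>, run until time \<open>j\<close> on a grid of
  mesh \<open>(1/2) ^ m j\<close>. The exceptional event \<open>F j\<close> is that the path exits by time \<open>j\<close> while no grid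
  time up to the exit sees it outside the ball. Off \<open>F j\<close>, the walk is frozen at a time not after the
  exit, so \<open>W j\<close> lies in the closed disc, and it converges to the exit point as \<open>r j\<close> tends to \<open>1\<close>.
  Bounded convergence applies there. On \<open>F j\<close> the walk may be far outside the disc, but \<open>F j\<close> has
  small probability for a fine mesh, since \<open>r j\<close> is smaller than the modulus of the exit point. The
  second moment bound of the walk depends on \<open>j\<close> and not on the mesh, so the mesh can be chosen after
  it, to make the contribution of \<open>F j\<close> negligible.\<close>

theorem exit_point_exp:
  fixes c :: real
  defines "V \<equiv> {z. 0 < cmod z \<and> cmod z < 1}"
  assumes a: "a \<in> V"
  shows "expectation (\<lambda>\<omega>. exp (of_real c * exit_point B V \<omega>)) = exp (of_real c * a)"
proof -
  have V: "open V" "V \<noteq> UNIV" using punctured_disc_open[of V] by (simp_all add: V_def)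
  define \<tau> where "\<tau> \<omega> = real_of_ereal (exit_time B V \<omega>)" for \<omega>
  define P where "P = exit_point B V"
  have P_eq: "P \<omega> = B (\<tau> \<omega>) \<omega>" for \<omega> by (simp add: P_def \<tau>_def exit_point_def)
  have [measurable]: "\<tau> \<in> borel_measurable M"
    unfolding \<tau>_def using exit_time_measurable[OF V] by measurable
  have [measurable]: "P \<in> borel_measurable M" unfolding P_def by (rule exit_point_measurable[OF V])
  have Bm [measurable]: "B (real k * (1/2) ^ m) \<in> borel_measurable M" for k m by (intro random_variable) simp

  define good where "good \<omega> \<longleftrightarrow> \<omega> \<in> space M \<and> B 0 \<omega> = a \<and> 0 \<le> \<tau> \<omega> \<and> cmod (P \<omega>) = 1
    \<and> (\<forall>s. 0 \<le> s \<longrightarrow> s < \<tau> \<omega> \<longrightarrow> cmod (B s \<omega>) < 1)" for \<omega>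
  have "a \<noteq> 0" using a by (auto simp: V_def)
  have good: "AE \<omega> in M. good \<omega>"
    using start never_hits_zero[OF \<open>a \<noteq> 0\<close>] leaves_disc AE_space
  proof eventually_elim
    case (elim \<omega>)
    have B0: "cmod (B 0 \<omega>) < 1" using a elim(1) by (simp add: V_def)
    have nz: "B t \<omega> \<noteq> 0" if "0 \<le> t" for t using elim(2) that by blast
    note e = exit_time_punctured_disc[where B=B and \<omega>=\<omega>, OF continuous_paths[OF elim(4)] B0 nz elim(3), folded V_def, folded \<tau>_def]
    show ?case unfolding good_def P_eq using e elim by blast
  qed

  define r where "r j = 1 - 1 / (real j + 2)" for j :: nat
  have r: "0 < r j" "r j < 1" for j by (auto simp: r_def field_simps)
  have r_lim: "r \<longlonglongrightarrow> 1" unfolding r_def by real_asymp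
  define E where "E j m = {\<omega>\<in>space M. \<tau> \<omega> \<le> real j \<and>
      (\<forall>k. real k * (1/2) ^ m \<le> \<tau> \<omega> \<longrightarrow> cmod (B (real k * (1/2) ^ m) \<omega>) < r j)}" for j m
  have E [measurable]: "E j m \<in> sets M" for j m unfolding E_def by measurable
  have E_lim: "(\<lambda>m. prob (E j m)) \<longlonglongrightarrow> 0" for j
  proof -
    have "(\<lambda>m. expectation (indicator (E j m) :: _ \<Rightarrow> real)) \<longlonglongrightarrow> expectation (\<lambda>_. 0)"
    proof (rule integral_dominated_convergence[where w="\<lambda>_. 1"])
      show "AE \<omega> in M. (\<lambda>m. indicat_real (E j m) \<omega>) \<longlonglongrightarrow> 0"
        using good
      proof eventually_elim
        case (elim \<omega>)
        then have \<omega>: "\<omega> \<in> space M" "0 \<le> \<tau> \<omega>" "cmod (P \<omega>) = 1" by (auto simp: good_def)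
        have "0 < 1 - r j" using r[of j] by simp
        from dyadic_approx[OF continuous_paths[OF \<omega>(1)] \<omega>(2) this]
        have "\<forall>\<^sub>F m in sequentially. indicat_real (E j m) \<omega> = 0"
        proof (rule eventually_mono)
          fix m
          let ?s = "real (nat \<lfloor>\<tau> \<omega> * 2 ^ m\<rfloor>) * (1/2) ^ m"
          assume *: "?s \<le> \<tau> \<omega> \<and> dist (B ?s \<omega>) (B (\<tau> \<omega>) \<omega>) < 1 - r j"
          have "cmod (P \<omega>) \<le> cmod (B ?s \<omega>) + dist (B ?s \<omega>) (B (\<tau> \<omega>) \<omega>)"
            unfolding P_eq dist_norm by (metis norm_minus_commute norm_triangle_sub)
          then have "\<not> cmod (B ?s \<omega>) < r j" using * \<omega>(3) by linarith
          then have "\<omega> \<notin> E j m" using * unfolding E_def by blast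
          then show "indicat_real (E j m) \<omega> = 0" by simp
        qed
        then show ?case by (rule tendsto_eventually)
      qed
    qed (auto simp: indicator_def)
    then show ?thesis by simp
  qed
  \<comment> \<open>A bound for the second moment of \<open>exp (c * z)\<close> at time \<open>j\<close>. The summand \<open>1\<close> ensures \<open>(1/2) ^ j / K j \<le> 1\<close>.\<close>
  define K where "K j = 1 + exp ((2 * c)\<^sup>2 / 2 * real j) * exp (2 * c * Re a)" for j :: nat
  have K: "1 \<le> K j" for j by (simp add: K_def)
  have "\<exists>m. prob (E j m) \<le> (1/2) ^ j * ((1/2) ^ j / K j)" for j
  proof -
    have "0 < (1/2) ^ j * ((1/2) ^ j / K j)" using K[of j] by simp
    from order_tendstoD(2)[OF E_lim this, of j] show ?thesis
      using eventually_happens'[OF sequentially_bot] less_imp_le by blast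
  qed
  then obtain m where m: "\<And>j. prob (E j (m j)) \<le> (1/2) ^ j * ((1/2) ^ j / K j)" by metis
  define F where "F j = E j (m j)" for j
  define W where "W j = walk (ball 0 (r j)) ((1/2) ^ m j) (j * 2 ^ m j)" for j
  have F [measurable]: "F j \<in> sets M" for j by (simp add: F_def E)
  have h: "0 < (1/2 :: real) ^ i" "ball (0::complex) (r j) \<in> sets borel" for i j by auto
  have W [measurable]: "W j \<in> borel_measurable M" for j
    unfolding W_def by (rule walk_measurable) (use h in auto)
  have steps: "(1/2) ^ i * real (j * 2 ^ i) = real j" for i j by (simp flip: power_mult_distrib)
  define f where "f z = exp (of_real c * z)" for z :: complex
  have f_cont: "continuous_on UNIV f" unfolding f_def by (intro continuous_intros)
  have fm [measurable]: "f \<in> borel_measurable borel" by (rule borel_measurable_continuous_onI[OF f_cont])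
  have f_bound: "cmod (f z) \<le> exp \<bar>c\<bar>" if "cmod z \<le> 1" for z
  proof -
    have "c * Re z \<le> \<bar>c\<bar> * \<bar>Re z\<bar>" by (metis abs_ge_self abs_mult)
    also have "\<dots> \<le> \<bar>c\<bar> * 1" using abs_Re_le_cmod[of z] that by (intro mult_left_mono) auto
    finally show ?thesis by (simp add: f_def)
  qed
  have fW_int: "integrable M (\<lambda>\<omega>. f (W j \<omega>))" and fW: "expectation (\<lambda>\<omega>. f (W j \<omega>)) = f a" for j
    unfolding f_def W_def using walk_exp[OF h(2) h(1)] by auto
  have fW2_int: "integrable M (\<lambda>\<omega>. (cmod (f (W j \<omega>)))\<^sup>2)"
    and fW2: "expectation (\<lambda>\<omega>. (cmod (f (W j \<omega>)))\<^sup>2) \<le> K j" for j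
  proof -
    have sq: "(cmod (f z))\<^sup>2 = exp (2 * c * Re z)" for z by (simp add: f_def flip: exp_double) 
    have eq: "(2 * c)\<^sup>2 * (1/2) ^ m j / 2 * real (j * 2 ^ m j) = (2 * c)\<^sup>2 / 2 * real j"
      unfolding steps[of "m j" j, symmetric] by (simp only: times_divide_eq_left times_divide_eq_right mult.assoc)
    note w = walk_exp_Re[OF h(2) h(1), of "2 * c" j "m j" "j * 2 ^ m j", unfolded eq, folded W_def]
    show "integrable M (\<lambda>\<omega>. (cmod (f (W j \<omega>)))\<^sup>2)"
      unfolding sq using w by (rule conjunct1)
    show "expectation (\<lambda>\<omega>. (cmod (f (W j \<omega>)))\<^sup>2) \<le> K j"
      unfolding sq K_def using conjunct2[OF w] by linarith
  qed
  have close: "cmod (W j \<omega>) \<le> 1 \<and> (\<tau> \<omega> \<le> real j \<longrightarrow> (\<exists>s. 0 \<le> s \<and> s \<le> \<tau> \<omega> \<and> W j \<omega> = B s \<omega> \<and> r j \<le> cmod (B s \<omega>)))"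
    if g: "good \<omega>" and nF: "\<omega> \<notin> F j" for \<omega> j
  proof -
    let ?h = "(1/2 :: real) ^ m j"
    let ?n = "j * 2 ^ m j"
    obtain k where k: "k \<le> ?n" "W j \<omega> = B (real k * ?h) \<omega>"
        "\<forall>i<k. B (real i * ?h) \<omega> \<in> ball 0 (r j)" "B (real k * ?h) \<omega> \<notin> ball 0 (r j) \<or> k = ?n"
      using walk_on_path[of \<omega> ?n "ball 0 (r j)" ?h] g unfolding W_def good_def by blast
    have in_disc: "cmod (B s \<omega>) \<le> 1" if "0 \<le> s" "s \<le> \<tau> \<omega>" for s
      using g that by (cases "s = \<tau> \<omega>") (auto simp: good_def P_eq less_imp_le)
    show ?thesis
    proof (cases "\<tau> \<omega> \<le> real j")
      case True
      then obtain l where l: "real l * ?h \<le> \<tau> \<omega>" "r j \<le> cmod (B (real l * ?h) \<omega>)"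
        using nF g by (auto simp: F_def E_def good_def not_less)
      have kl: "k \<le> l" using k(3) l(2) by (meson not_le mem_ball_0)
      have "real k * ?h \<le> real l * ?h" using kl by (intro mult_right_mono) auto
      then have s: "real k * ?h \<le> \<tau> \<omega>" using l(1) by linarith
      have "real l * ?h \<le> ?h * real ?n" using l(1) True unfolding steps by linarith
      then have "real l \<le> real ?n" by (simp add: mult.commute)
      then have "l \<le> ?n" by (simp only: of_nat_le_iff)
      then have "B (real k * ?h) \<omega> \<notin> ball 0 (r j)" using k(4) kl l(2) by (cases "k = l") auto
      then have "r j \<le> cmod (B (real k * ?h) \<omega>)" by (simp add: not_less)
      moreover have "0 \<le> real k * ?h" by simp
      ultimately show ?thesis using s k(2) in_disc by metis
    next
      case False
      have "real k * ?h \<le> real ?n * ?h" using k(1) by (intro mult_right_mono) (auto simp del: of_nat_mult of_nat_power)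
      also have "\<dots> = real j" by (subst mult.commute) (rule steps)
      finally have "real k * ?h \<le> \<tau> \<omega>" using False by linarith
      then show ?thesis using False k(2) in_disc by simp
    qed
  qed
  let ?I = "\<lambda>A \<omega>. indicator A \<omega> :: real"
  define D where "D j \<omega> = f (W j \<omega>) - f (P \<omega>)" for j \<omega>
  have D [measurable]: "D j \<in> borel_measurable M" for j unfolding D_def by measurable
  have fP: "AE \<omega> in M. cmod (f (P \<omega>)) \<le> exp \<bar>c\<bar>"
    using good by eventually_elim (auto simp: good_def intro!: f_bound)
  have fP_int: "integrable M (\<lambda>\<omega>. f (P \<omega>))"
    by (rule integrable_const_bound[OF fP]) measurable
  have D_int: "integrable M (D j)" for j unfolding D_def using fW_int fP_int by simp
  have typical: "(\<lambda>j. expectation (\<lambda>\<omega>. ?I (- F j) \<omega> *\<^sub>R D j \<omega>)) \<longlonglongrightarrow> expectation (\<lambda>_. 0)"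
  proof (rule integral_dominated_convergence[where w="\<lambda>_. 2 * exp \<bar>c\<bar>"])
    show "AE \<omega> in M. (\<lambda>j. ?I (- F j) \<omega> *\<^sub>R D j \<omega>) \<longlonglongrightarrow> 0"
      using good
    proof eventually_elim
      case (elim \<omega>)
      show ?case unfolding tendsto_iff
      proof (intro allI impI)
        fix e :: real assume e: "0 < e"
        obtain d where d: "0 < d" "\<And>z. dist z (P \<omega>) < d \<Longrightarrow> dist (f z) (f (P \<omega>)) < e"
          using f_cont e unfolding continuous_on_iff by (metis UNIV_I)
        obtain r0 where r0: "r0 < 1" "\<And>s. 0 \<le> s \<Longrightarrow> s \<le> \<tau> \<omega> \<Longrightarrow> r0 \<le> cmod (B s \<omega>) \<Longrightarrow> dist (B s \<omega>) (P \<omega>) < d"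
          using first_exit_continuity[OF continuous_paths, of \<omega> "\<tau> \<omega>" d] elim d(1) unfolding good_def P_eq by metis
        have "\<forall>\<^sub>F j in sequentially. r0 < r j" by (rule order_tendstoD(1)[OF r_lim r0(1)])
        moreover have "\<forall>\<^sub>F j in sequentially. \<tau> \<omega> \<le> real j"
          using eventually_ge_at_top[of "nat \<lceil>\<tau> \<omega>\<rceil>"] by eventually_elim linarith
        ultimately show "\<forall>\<^sub>F j in sequentially. dist (?I (- F j) \<omega> *\<^sub>R D j \<omega>) 0 < e"
        proof eventually_elim
          case (elim j)
          show ?case
          proof (cases "\<omega> \<in> F j")
            case True then show ?thesis using e by simp
          next
            case False
            from close[OF \<open>good \<omega>\<close> this] elim(2)
            obtain s where s: "0 \<le> s" "s \<le> \<tau> \<omega>" "W j \<omega> = B s \<omega>" "r j \<le> cmod (B s \<omega>)" by blast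
            have "dist (W j \<omega>) (P \<omega>) < d" unfolding s(3) using s elim(1) by (intro r0(2)) auto
            then show ?thesis using d(2) False by (auto simp: D_def dist_norm)
          qed
        qed
      qed
    qed
    show "AE \<omega> in M. norm (?I (- F j) \<omega> *\<^sub>R D j \<omega>) \<le> 2 * exp \<bar>c\<bar>" for j
      using good fP
    proof eventually_elim
      case (elim \<omega>)
      have "cmod (D j \<omega>) \<le> 2 * exp \<bar>c\<bar>" if "\<omega> \<notin> F j"
        using norm_triangle_ineq4[of "f (W j \<omega>)" "f (P \<omega>)"] f_bound[of "W j \<omega>"] close[OF elim(1) that] elim(2)
        unfolding D_def by linarith
      then show ?case by (auto simp: indicator_def)
    qed
  qed measurable
  have rare: "norm (expectation (\<lambda>\<omega>. ?I (F j) \<omega> *\<^sub>R D j \<omega>)) \<le> (2 + exp \<bar>c\<bar>) * (1/2) ^ j" for j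
  proof -
    \<comment> \<open>The weight in \<open>x \<le> \<eta> * x\<^sup>2 + 1 / \<eta>\<close>: it makes \<open>\<eta> * K j\<close> and \<open>prob (F j) / \<eta>\<close> both at most \<open>(1/2) ^ j\<close>.\<close>
    define \<eta> where "\<eta> = (1/2) ^ j / K j"
    have \<eta>: "0 < \<eta>" using K[of j] by (simp add: \<eta>_def)
    have amgm: "x \<le> \<eta> * x\<^sup>2 + 1 / \<eta>" if "0 \<le> x" for x
    proof -
      have "0 \<le> (\<eta> * x - 1)\<^sup>2 + \<eta> * x" using that \<eta> by simp
      then have "\<eta> * x \<le> \<eta> * (\<eta> * x\<^sup>2) + 1" by (simp add: power2_eq_square algebra_simps)
      also have "\<dots> = \<eta> * (\<eta> * x\<^sup>2 + 1 / \<eta>)" using \<eta> by (simp add: algebra_simps)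
      finally show ?thesis using \<eta> by simp
    qed
    let ?b = "\<lambda>\<omega>. \<eta> * (cmod (f (W j \<omega>)))\<^sup>2 + (1 / \<eta> + exp \<bar>c\<bar>) * ?I (F j) \<omega>"
    have b1: "integrable M (\<lambda>\<omega>. \<eta> * (cmod (f (W j \<omega>)))\<^sup>2)"
      by (intro integrable_mult_right fW2_int)
    have b2: "integrable M (\<lambda>\<omega>. (1 / \<eta> + exp \<bar>c\<bar>) * ?I (F j) \<omega>)"
      by (intro integrable_mult_right integrable_real_indicator F) (simp add: emeasure_eq_measure)
    have "norm (expectation (\<lambda>\<omega>. ?I (F j) \<omega> *\<^sub>R D j \<omega>)) \<le> expectation (\<lambda>\<omega>. norm (?I (F j) \<omega> *\<^sub>R D j \<omega>))"
      by (rule integral_norm_bound)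
    also have "\<dots> \<le> expectation ?b"
    proof (rule integral_mono_AE)
      show "integrable M (\<lambda>\<omega>. norm (?I (F j) \<omega> *\<^sub>R D j \<omega>))"
        by (intro integrable_norm integrable_mult_indicator[OF F D_int])
      show "integrable M ?b" by (rule Bochner_Integration.integrable_add[OF b1 b2])
      show "AE \<omega> in M. norm (?I (F j) \<omega> *\<^sub>R D j \<omega>) \<le> ?b \<omega>"
        using fP
      proof eventually_elim
        case (elim \<omega>)
        have "norm (D j \<omega>) \<le> cmod (f (W j \<omega>)) + exp \<bar>c\<bar>"
          unfolding D_def using norm_triangle_ineq4[of "f (W j \<omega>)" "f (P \<omega>)"] elim by linarith
        then have "norm (D j \<omega>) \<le> \<eta> * (cmod (f (W j \<omega>)))\<^sup>2 + (1 / \<eta> + exp \<bar>c\<bar>)"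
          using amgm[of "cmod (f (W j \<omega>))"] by simp
        moreover have "0 \<le> \<eta> * (cmod (f (W j \<omega>)))\<^sup>2" using \<eta> by simp
        ultimately show ?case by (auto simp: indicator_def)
      qed
    qed
    also have "expectation ?b = \<eta> * expectation (\<lambda>\<omega>. (cmod (f (W j \<omega>)))\<^sup>2) + (1 / \<eta> + exp \<bar>c\<bar>) * prob (F j)"
      unfolding Bochner_Integration.integral_add[OF b1 b2] by simp
    also have "\<dots> \<le> \<eta> * K j + (1 / \<eta> + exp \<bar>c\<bar>) * ((1/2) ^ j * \<eta>)"
      using \<eta> fW2 m[of j] unfolding F_def \<eta>_def[symmetric] by (intro add_mono mult_left_mono) auto
    also have "\<dots> = (1/2) ^ j + (1/2) ^ j + exp \<bar>c\<bar> * ((1/2) ^ j * \<eta>)"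
      using \<eta> K[of j] by (simp add: algebra_simps) (simp add: \<eta>_def)
    also have "\<dots> \<le> (1/2) ^ j + (1/2) ^ j + exp \<bar>c\<bar> * ((1/2) ^ j * 1)"
    proof -
      have "(1/2 :: real) ^ j \<le> 1" by (simp add: power_le_one)
      then have "\<eta> \<le> 1" using K[of j] by (simp add: \<eta>_def)
      then show ?thesis by (intro add_left_mono mult_left_mono) auto
    qed
    finally show ?thesis by (simp add: algebra_simps)
  qed
  have "(\<lambda>j. (2 + exp \<bar>c\<bar>) * (1/2 :: real) ^ j) \<longlonglongrightarrow> (2 + exp \<bar>c\<bar>) * 0"
    by (intro tendsto_mult_left LIMSEQ_power_zero) simp
  then have bound_lim: "(\<lambda>j. (2 + exp \<bar>c\<bar>) * (1/2 :: real) ^ j) \<longlonglongrightarrow> 0"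
    by (simp only: mult_zero_right)
  have "(\<lambda>j. expectation (\<lambda>\<omega>. ?I (F j) \<omega> *\<^sub>R D j \<omega>)) \<longlonglongrightarrow> 0"
    by (rule Lim_null_comparison[OF always_eventually bound_lim]) (rule allI, rule rare)
  from tendsto_add[OF typical this]
  have "(\<lambda>j. expectation (\<lambda>\<omega>. ?I (- F j) \<omega> *\<^sub>R D j \<omega>) + expectation (\<lambda>\<omega>. ?I (F j) \<omega> *\<^sub>R D j \<omega>)) \<longlonglongrightarrow> 0" by simp
  moreover have "expectation (\<lambda>\<omega>. ?I (- F j) \<omega> *\<^sub>R D j \<omega>) + expectation (\<lambda>\<omega>. ?I (F j) \<omega> *\<^sub>R D j \<omega>)
      = f a - expectation (\<lambda>\<omega>. f (P \<omega>))" for j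
  proof -
    have i1: "integrable M (\<lambda>\<omega>. ?I (F j) \<omega> *\<^sub>R D j \<omega>)"
      by (rule integrable_mult_indicator[OF F D_int])
    have eq: "?I (- F j) \<omega> *\<^sub>R D j \<omega> = D j \<omega> - ?I (F j) \<omega> *\<^sub>R D j \<omega>" for \<omega> by (simp add: indicator_def)
    have "expectation (D j) = f a - expectation (\<lambda>\<omega>. f (P \<omega>))"
      unfolding D_def Bochner_Integration.integral_diff[OF fW_int fP_int] fW ..
    then show ?thesis
      unfolding eq Bochner_Integration.integral_diff[OF D_int i1] by simp
  qed
  ultimately have "f a - expectation (\<lambda>\<omega>. f (P \<omega>)) = 0"
    by (simp add: LIMSEQ_const_iff)
  then show ?thesis by (simp add: f_def P_def)
qed

end

section \<open>The exit distribution\<close>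

text \<open>Both sides of the hypothesis are power series in \<open>c\<close>, with the moments divided by factorials as
  coefficients. They agree for real \<open>c\<close>, and real points accumulate at \<open>0\<close>, so the coefficients agree.\<close>

lemma (in prob_space) moments_of_exp_moments:
  fixes X :: "'a \<Rightarrow> complex"
  assumes X [measurable]: "X \<in> borel_measurable M" and bd: "AE \<omega> in M. cmod (X \<omega>) \<le> 1" and b: "cmod b \<le> 1"
    and exp: "\<And>c::real. expectation (\<lambda>\<omega>. exp (of_real c * X \<omega>)) = exp (of_real c * b)"
  shows "expectation (\<lambda>\<omega>. X \<omega> ^ n) = b ^ n"
proof -
  define e where "e n = (expectation (\<lambda>\<omega>. X \<omega> ^ n) - b ^ n) / fact n" for n
  have pow_bd: "AE \<omega> in M. cmod (X \<omega> ^ n) \<le> 1" for n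
    using bd by eventually_elim (simp add: norm_power power_le_one)
  have pow_int: "integrable M (\<lambda>\<omega>. X \<omega> ^ n)" for n
    by (rule integrable_const_bound[OF pow_bd]) measurable
  have mom_bd: "cmod (expectation (\<lambda>\<omega>. X \<omega> ^ n)) \<le> 1" for n
  proof -
    have "cmod (expectation (\<lambda>\<omega>. X \<omega> ^ n)) \<le> expectation (\<lambda>\<omega>. cmod (X \<omega> ^ n))" by (rule integral_norm_bound)
    also have "\<dots> \<le> expectation (\<lambda>_. 1)"
      by (rule integral_mono_AE) (use pow_int pow_bd in auto)
    finally show ?thesis by (simp add: prob_space)
  qed
  have summ: "summable (\<lambda>n. e n * z ^ n)" for z
  proof (rule summable_comparison_test')
    show "summable (\<lambda>n. 2 * (cmod z ^ n / fact n))"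
      using summable_exp[of "cmod z"] by (intro summable_mult) (simp add: field_simps)
    fix n
    have "cmod (expectation (\<lambda>\<omega>. X \<omega> ^ n) - b ^ n) \<le> 1 + 1"
      using norm_triangle_ineq4[of "expectation (\<lambda>\<omega>. X \<omega> ^ n)" "b ^ n"] mom_bd[of n] power_le_one[OF norm_ge_zero b, of n]
      unfolding norm_power by linarith
    then have "cmod (expectation (\<lambda>\<omega>. X \<omega> ^ n) - b ^ n) * (cmod z ^ n / fact n) \<le> 2 * (cmod z ^ n / fact n)"
      by (intro mult_right_mono) auto
    then show "norm (e n * z ^ n) \<le> 2 * (cmod z ^ n / fact n)"
      by (simp add: e_def norm_mult norm_divide norm_power)
  qed
  define g where "g z = (\<Sum>n. e n * z ^ n)" for z
  have g_real: "g (of_real c) = 0" for c :: real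
  proof -
    let ?z = "of_real c :: complex"
    have s1: "(\<lambda>n. expectation (\<lambda>\<omega>. (?z * X \<omega>) ^ n /\<^sub>R fact n)) sums expectation (\<lambda>\<omega>. \<Sum>n. (?z * X \<omega>) ^ n /\<^sub>R fact n)"
    proof (rule sums_integral)
      have "(\<lambda>\<omega>. (?z * X \<omega>) ^ n /\<^sub>R fact n) = (\<lambda>\<omega>. (?z ^ n /\<^sub>R fact n) * X \<omega> ^ n)" for n
        by (simp add: fun_eq_iff power_mult_distrib)
      then show int: "integrable M (\<lambda>\<omega>. (?z * X \<omega>) ^ n /\<^sub>R fact n)" for n
        using pow_int[of n] by simp
      show "AE \<omega> in M. summable (\<lambda>n. norm ((?z * X \<omega>) ^ n /\<^sub>R fact n))"
        by (intro AE_I2 summable_norm_exp)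
      show "summable (\<lambda>n. expectation (\<lambda>\<omega>. norm ((?z * X \<omega>) ^ n /\<^sub>R fact n)))"
      proof (rule summable_comparison_test')
        show "summable (\<lambda>n. \<bar>c\<bar> ^ n / fact n)"
          using summable_exp[of "\<bar>c\<bar>"] by (simp add: field_simps)
        fix n
        have "expectation (\<lambda>\<omega>. norm ((?z * X \<omega>) ^ n /\<^sub>R fact n)) \<le> expectation (\<lambda>_. \<bar>c\<bar> ^ n / fact n)"
        proof (rule integral_mono_AE)
          show "AE \<omega> in M. norm ((?z * X \<omega>) ^ n /\<^sub>R fact n) \<le> \<bar>c\<bar> ^ n / fact n"
            using pow_bd[of n]
          proof eventually_elim
            case (elim \<omega>)
            have "norm ((?z * X \<omega>) ^ n /\<^sub>R fact n) = cmod (X \<omega> ^ n) * (\<bar>c\<bar> ^ n / fact n)"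
              by (simp add: norm_mult norm_power power_mult_distrib field_simps)
            also have "\<dots> \<le> 1 * (\<bar>c\<bar> ^ n / fact n)" by (intro mult_right_mono elim) auto
            finally show ?case by simp
          qed
          show "integrable M (\<lambda>\<omega>. norm ((?z * X \<omega>) ^ n /\<^sub>R fact n))" by (intro integrable_norm int)
        qed simp
        then show "norm (expectation (\<lambda>\<omega>. norm ((?z * X \<omega>) ^ n /\<^sub>R fact n))) \<le> \<bar>c\<bar> ^ n / fact n"
          by (simp add: prob_space)
      qed
    qed
    have "(\<Sum>n. (?z * X \<omega>) ^ n /\<^sub>R fact n) = exp (?z * X \<omega>)" for \<omega> by (simp add: exp_def)
    with s1 have s1: "(\<lambda>n. expectation (\<lambda>\<omega>. (?z * X \<omega>) ^ n /\<^sub>R fact n)) sums exp (?z * b)"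
      by (simp add: exp)
    have "(\<lambda>n. (?z * b) ^ n /\<^sub>R fact n) sums exp (?z * b)" by (rule exp_converges)
    from sums_diff[OF s1 this]
    have "(\<lambda>n. expectation (\<lambda>\<omega>. (?z * X \<omega>) ^ n /\<^sub>R fact n) - (?z * b) ^ n /\<^sub>R fact n) sums 0" by simp
    moreover have "expectation (\<lambda>\<omega>. (?z * X \<omega>) ^ n /\<^sub>R fact n) - (?z * b) ^ n /\<^sub>R fact n = e n * ?z ^ n" for n
      by (simp add: e_def power_mult_distrib scaleR_conv_of_real field_simps)
    ultimately show ?thesis unfolding g_def by (simp add: sums_iff)
  qed
  have "e n = 0" for n
  proof (rule ccontr)
    assume n: "e n \<noteq> 0"
    have "e 0 = 0" using g_real[of 0] by (simp add: g_def)
    then have "n > 0" using n by (cases n) auto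
    have "\<exists>s>0. \<forall>z\<in>cball 0 s - {0}. g z \<noteq> 0"
    proof -
      obtain s where "0 < s" "\<And>z. z \<in> cball 0 s - {0} \<Longrightarrow> g z \<noteq> 0"
        by (rule powser_0_nonzero[of 1 0 e g n]) (use summ n \<open>n > 0\<close> g_real[of 0] in \<open>auto simp: g_def summable_sums\<close>)
      then show ?thesis by blast
    qed
    then obtain s where s: "0 < s" "\<And>z. z \<in> cball 0 s - {0} \<Longrightarrow> g z \<noteq> 0" by blast
    have "of_real s \<in> cball (0::complex) s - {0}" using s(1) by simp
    from s(2)[OF this] show False by (simp add: g_real)
  qed
  then show ?thesis by (simp add: e_def)
qed

theorem mainTheorem4:
  fixes M :: "'w measure" and a :: complex and B :: "real \<Rightarrow> 'w \<Rightarrow> complex"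
    and V :: "complex set" and \<alpha> :: real
  assumes V: "V = {z. 0 < cmod z \<and> cmod z < 1}"
    and a: "a \<in> V"
    and arg: "is_Arg a \<alpha>"
    and B: "planar_brownian_motion M a B"
  shows "(AE \<omega> in M. exit_time B V \<omega> < \<infinity>) \<and>
    (\<exists>\<rho> :: complex \<Rightarrow> real.
       distributed M circle_arclength (exit_point B V) (\<lambda>z. ennreal (\<rho> z)) \<and>
       (\<forall>\<theta>::real.
          ((\<lambda>k::int. - ln (cmod a) /
              (pi * ((ln (cmod a))\<^sup>2 + (\<alpha> - (\<theta> + 2 * pi * of_int k))\<^sup>2)))
            has_sum \<rho> (cis \<theta>)) UNIV))"
proof -
  interpret planar_brownian_motion M a B by fact
  have a0: "a \<noteq> 0" and a1: "cmod a < 1" using a by (auto simp: V)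
  have P [measurable]: "exit_point B V \<in> borel_measurable M"
    by (rule exit_point_measurable[OF punctured_disc_open[OF V]])
  have exits: "AE \<omega> in M. exit_time B V \<omega> < \<infinity> \<and> cmod (exit_point B V \<omega>) = 1"
    using start never_hits_zero[OF a0] leaves_disc AE_space
  proof eventually_elim
    case (elim \<omega>)
    have B0: "cmod (B 0 \<omega>) < 1" using a1 elim(1) by simp
    have nz: "B t \<omega> \<noteq> 0" if "0 \<le> t" for t using elim(2) that by blast
    note e = exit_time_punctured_disc[where B=B and \<omega>=\<omega>, OF continuous_paths[OF elim(4)] B0 nz elim(3), folded V]
    have "exit_time B V \<omega> < \<infinity>" by (subst e(1)) auto
    then show ?case using e(3) by (simp add: exit_point_def)
  qed
  have moments: "expectation (\<lambda>\<omega>. exit_point B V \<omega> ^ n) = a ^ n" for n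
  proof (rule moments_of_exp_moments[OF P])
    show "AE \<omega> in M. cmod (exit_point B V \<omega>) \<le> 1" using exits by eventually_elim simp
    show "expectation (\<lambda>\<omega>. exp (of_real c * exit_point B V \<omega>)) = exp (of_real c * a)" for c :: real
      using exit_point_exp[of c] a unfolding V by blast
  qed (use a1 in simp)

  let ?\<rho> = "poisson_kernel a" and ?C = circle_arclength
  have sets_C [measurable_cong]: "sets ?C = sets borel" by (simp add: circle_arclength_def)
  have \<rho>_nonneg: "AE z in ?C. 0 \<le> ?\<rho> z"
    using AE_circle_arclength by eventually_elim (use a1 in \<open>auto intro!: poisson_kernel_nonneg\<close>)
  let ?\<nu> = "density ?C (\<lambda>z. ennreal (?\<rho> z))"
  \<comment> \<open>The moment of order \<open>0\<close> shows that the kernel is a probability density.\<close>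
  have \<rho>_int: "integrable ?C ?\<rho>" and \<rho>_mass: "(\<integral>z. ?\<rho> z \<partial>?C) = 1"
  proof -
    have "(\<integral>z. complex_of_real (?\<rho> z) \<partial>?C) = 1"
      using poisson_kernel_moment[OF a1, of 0] by (simp add: scaleR_conv_of_real)
    then show m: "(\<integral>z. ?\<rho> z \<partial>?C) = 1"
      by (metis integral_complex_of_real of_real_eq_1_iff)
    then show "integrable ?C ?\<rho>" by (metis not_integrable_integral_eq zero_neq_one)
  qed
  have "distr M borel (exit_point B V) = ?\<nu>"
  proof (rule circle_measure_eqI)
    show "finite_measure (distr M borel (exit_point B V))" by (rule finite_measure_distr) simp
    show "AE z in distr M borel (exit_point B V). cmod z = 1"
      by (subst AE_distr_iff) (use exits in \<open>auto elim: eventually_mono\<close>)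
    show "finite_measure ?\<nu>"
    proof
      have "emeasure ?\<nu> (space ?\<nu>) = (\<integral>\<^sup>+z. ennreal (?\<rho> z) \<partial>?C)"
        by (subst emeasure_density) (auto intro!: nn_integral_cong)
      also have "\<dots> = ennreal 1" using nn_integral_eq_integral[OF \<rho>_int \<rho>_nonneg] by (simp only: \<rho>_mass)
      finally show "emeasure ?\<nu> (space ?\<nu>) \<noteq> \<infinity>" by simp
    qed
    show "AE z in ?\<nu>. cmod z = 1"
      by (subst AE_density) (use AE_circle_arclength in \<open>auto elim: eventually_mono\<close>)
    fix n
    have "(\<integral>z. z ^ n \<partial>distr M borel (exit_point B V)) = a ^ n"
      by (subst integral_distr) (auto simp: moments)
    also have "\<dots> = (\<integral>z. z ^ n \<partial>?\<nu>)"
      by (subst integral_density) (use \<rho>_nonneg in \<open>auto simp: poisson_kernel_moment[OF a1]\<close>)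
    finally show "(\<integral>z. z ^ n \<partial>distr M borel (exit_point B V)) = (\<integral>z. z ^ n \<partial>?\<nu>)" .
  qed (auto simp: sets_C)
  moreover have "distr M ?C (exit_point B V) = distr M borel (exit_point B V)"
    by (rule distr_cong) (auto simp: sets_C)
  ultimately have "distributed M ?C (exit_point B V) (\<lambda>z. ennreal (?\<rho> z))"
    unfolding distributed_def by simp
  moreover have "AE \<omega> in M. exit_time B V \<omega> < \<infinity>" using exits by eventually_elim simp
  ultimately show ?thesis
    using wrapped_cauchy_eq_poisson_kernel[OF a0 a1 arg] by blast
qed

end
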